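(* Let $d\in\mathbb{N}$ and let $p_1,\dots,p_d$ be integral polynomials with $p_i(0)=0$ for all $i$. (1) If $A$ is thick in $\mathbb{N}$, then $\{(m,n)\in \mathbb{N}^2: m+p_1(n),\dots,m+p_d(n)\in A\}$ is thick in $\mathbb{N}^2$. (2) Let "large" be any one of the notions "central*", "IP*", "IP$_{<\omega}$*", "IP$_n$*" (for $n\ge 2$), or "$\Delta$*". If $\max_i \deg p_i\geq 2$, then there exists a large set $A$ in $\mathbb{N}$ (resp. in $\mathbb{Z}$) such that the set $\{(m,n)\in\mathbb{N}^2 \text{ (resp. } \mathbb{Z}^2): m+p_1(n),\dots,m+p_d(n)\in A\}$ is not large (in $\mathbb{N}^2$, resp. $\mathbb{Z}^2$).
   Context: $\mathbb{N}=\{1,2,\dots\}$. An integral polynomial is a polynomial taking integer values at the integers. All notions below refer to a commutative semigroup $(S,+)$, here one of $\mathbb{N},\mathbb{Z},\mathbb{N}^2,\mathbb{Z}^2$ with coordinatewise addition. For $s\in S$, $A\subset S$, $-s+A=\{y\in S: s+y\in A\}$. Thick: $A\subset S$ is thick if for every finite nonempty $F\subset S$ there is $s\in S$ with $F+s\subset A$. Syndetic: there is a finite $F\subset S$ with $S=\bigcup_{s\in F}(-s+A)$. For a sequence $(x_i)$ in $S$ (finite or infinite), $FS((x_i))=\{\sum_{i\in\alpha}x_i:\alpha \text{ a finite nonempty set of indices}\}$. $A$ is an IP-set if $FS((x_i)_{i=1}^\infty)\subset A$ for some infinite sequence $(x_i)$ in $S$; IP* means meeting every IP-set. For $n\ge2$,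 $A$ is an IP$_n$-set if whenever $\mathcal{F}$ is a finite partition of $A$, there exist $F\in\mathcal{F}$ and $x_1,\dots,x_n\in S$ with $FS((x_t)_{t=1}^n)\subset F$. $A$ is an IP$_{<\omega}$-set if whenever $\mathcal{F}$ is a finite partition of $A$ and $n\in\mathbb{N}$, there exist $F\in\mathcal{F}$ and $x_1,\dots,x_n\in S$ with $FS((x_t)_{t=1}^n)\subset F$. IP$_n$* (resp. IP$_{<\omega}$* ) means meeting every IP$_n$-set (resp. IP$_{<\omega}$-set). $A$ is a $\Delta$-set if it contains $\{x_j-x_i: j>i\}$ for some infinite sequence $(x_i)$ of pairwise distinct elements (with all these differences lying in $S$); $\Delta$* means meeting every $\Delta$-set. A dynamical system $(X,(T_s)_{s\in S})$: $X$ compact metric space with metric $\rho$, each $T_s$ a homeomorphism of $X$, $T_s\circ T_t=T_{s+t}$. A point $y$ is uniformly recurrent if $\{s: T_sy\in U\}$ is syndetic for every neighborhood $U$ of $y$; $x$ is proximal to $y$ if $\rho(T_{s_k}x,T_{s_k}y)\to0$ for some sequence $(s_k)$ in $S$. $A\subset S$ is central if there are such a system, a point $x$, a uniformly recurrent point $y$ proximal to $x$, and a neighborhood $U$ of $y$ with $\{s\in S: T_sx\in U\}\subset A$. Central* means meeting every central set. *)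

theory Defs
  imports "HOL-Analysis.Analysis" "HOL-Library.Disjoint_Sets"
    "HOL-Computational_Algebra.Polynomial"
begin

text \<open>
  A commutative semigroup is given as an additively closed subset \<open>S\<close> of an abelian group:
  the semigroups of interest are \<open>Npos\<close> and \<open>UNIV\<close> in \<open>int\<close>, and \<open>Npos \<times> Npos\<close> and
  \<open>UNIV \<times> UNIV\<close> in \<open>int \<times> int\<close> (with coordinatewise addition). Every notion below is
  relative to \<open>S\<close> and includes the requirement \<open>A \<subseteq> S\<close>.
\<close>

definition Npos :: "int set" where
  "Npos = {1..}"

definition thick :: "'a::ab_group_add set \<Rightarrow> 'a set \<Rightarrow> bool" where
  "thick S A \<longleftrightarrow> A \<subseteq> S \<and>
     (\<forall>F. finite F \<longrightarrow> F \<noteq> {} \<longrightarrow> F \<subseteq> S \<longrightarrow> (\<exists>s\<in>S. (\<lambda>f. f + s) ` F \<subseteq> A))"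

definition syndetic :: "'a::ab_group_add set \<Rightarrow> 'a set \<Rightarrow> bool" where
  "syndetic S A \<longleftrightarrow> A \<subseteq> S \<and>
     (\<exists>F. finite F \<and> F \<subseteq> S \<and> S = (\<Union>s\<in>F. {y \<in> S. s + y \<in> A}))"

definition FS :: "'i set \<Rightarrow> ('i \<Rightarrow> 'a::ab_group_add) \<Rightarrow> 'a set" where
  "FS I x = {\<Sum>i\<in>\<alpha>. x i | \<alpha>. finite \<alpha> \<and> \<alpha> \<noteq> {} \<and> \<alpha> \<subseteq> I}"

definition IP_set :: "'a::ab_group_add set \<Rightarrow> 'a set \<Rightarrow> bool" where
  "IP_set S A \<longleftrightarrow> A \<subseteq> S \<and> (\<exists>x :: nat \<Rightarrow> 'a. range x \<subseteq> S \<and> FS UNIV x \<subseteq> A)"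

definition IP_n_set :: "nat \<Rightarrow> 'a::ab_group_add set \<Rightarrow> 'a set \<Rightarrow> bool" where
  "IP_n_set n S A \<longleftrightarrow> A \<subseteq> S \<and>
     (\<forall>P. finite P \<longrightarrow> partition_on A P \<longrightarrow>
        (\<exists>F\<in>P. \<exists>x :: nat \<Rightarrow> 'a. x ` {1..n} \<subseteq> S \<and> FS {1..n} x \<subseteq> F))"

definition IP_fin_set :: "'a::ab_group_add set \<Rightarrow> 'a set \<Rightarrow> bool" where
  "IP_fin_set S A \<longleftrightarrow> A \<subseteq> S \<and>
     (\<forall>P. \<forall>n\<ge>1. finite P \<longrightarrow> partition_on A P \<longrightarrow>
        (\<exists>F\<in>P. \<exists>x :: nat \<Rightarrow> 'a. x ` {1..n} \<subseteq> S \<and> FS {1..n} x \<subseteq> F))"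

definition Delta_set :: "'a::ab_group_add set \<Rightarrow> 'a set \<Rightarrow> bool" where
  "Delta_set S A \<longleftrightarrow> A \<subseteq> S \<and>
     (\<exists>x :: nat \<Rightarrow> 'a. inj x \<and> range x \<subseteq> S \<and> {x j - x i | i j. i < j} \<subseteq> A)"

definition dynamical_system ::
  "'a::ab_group_add set \<Rightarrow> 'x set \<Rightarrow> ('x \<Rightarrow> 'x \<Rightarrow> real) \<Rightarrow> ('a \<Rightarrow> 'x \<Rightarrow> 'x) \<Rightarrow> bool" where
  "dynamical_system S X \<rho> T \<longleftrightarrow>
     Metric_space X \<rho> \<and> compact_space (Metric_space.mtopology X \<rho>) \<and>
     (\<forall>s\<in>S. homeomorphic_map (Metric_space.mtopology X \<rho>) (Metric_space.mtopology X \<rho>) (T s)) \<and>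
     (\<forall>s\<in>S. \<forall>t\<in>S. \<forall>x\<in>X. T (s + t) x = T s (T t x))"

definition uniformly_recurrent ::
  "'a::ab_group_add set \<Rightarrow> 'x set \<Rightarrow> ('x \<Rightarrow> 'x \<Rightarrow> real) \<Rightarrow> ('a \<Rightarrow> 'x \<Rightarrow> 'x) \<Rightarrow> 'x \<Rightarrow> bool" where
  "uniformly_recurrent S X \<rho> T y \<longleftrightarrow> y \<in> X \<and>
     (\<forall>U. openin (Metric_space.mtopology X \<rho>) U \<longrightarrow> y \<in> U \<longrightarrow> syndetic S {s \<in> S. T s y \<in> U})"

definition proximal ::
  "'a::ab_group_add set \<Rightarrow> ('x \<Rightarrow> 'x \<Rightarrow> real) \<Rightarrow> ('a \<Rightarrow> 'x \<Rightarrow> 'x) \<Rightarrow> 'x \<Rightarrow> 'x \<Rightarrow> bool" where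
  "proximal S \<rho> T x y \<longleftrightarrow>
     (\<exists>s :: nat \<Rightarrow> 'a. range s \<subseteq> S \<and> (\<lambda>k. \<rho> (T (s k) x) (T (s k) y)) \<longlonglongrightarrow> 0)"

definition central_via ::
  "'a::ab_group_add set \<Rightarrow> 'a set \<Rightarrow> 'x set \<Rightarrow> ('x \<Rightarrow> 'x \<Rightarrow> real) \<Rightarrow> ('a \<Rightarrow> 'x \<Rightarrow> 'x) \<Rightarrow> bool" where
  "central_via S A X \<rho> T \<longleftrightarrow> dynamical_system S X \<rho> T \<and>
     (\<exists>x\<in>X. \<exists>y. uniformly_recurrent S X \<rho> T y \<and> proximal S \<rho> T x y \<and>
        (\<exists>U. openin (Metric_space.mtopology X \<rho>) U \<and> y \<in> U \<and> {s \<in> S. T s x \<in> U} \<subseteq> A))"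

text \<open>
  HOL cannot quantify over all types inside a definition, so the phase space is taken to be a set of
  reals carrying an arbitrary metric (not the Euclidean one). Since a compact metric space has at
  most continuum many points, this is no restriction: lemma \<open>central_viaI\<close> below shows that a
  system on any type will do.
\<close>

definition central :: "'a::ab_group_add set \<Rightarrow> 'a set \<Rightarrow> bool" where
  "central S A \<longleftrightarrow> A \<subseteq> S \<and> (\<exists>(X :: real set) \<rho> T. central_via S A X \<rho> T)"

definition star :: "('a set \<Rightarrow> 'a set \<Rightarrow> bool) \<Rightarrow> 'a set \<Rightarrow> 'a set \<Rightarrow> bool" where
  "star P S A \<longleftrightarrow> A \<subseteq> S \<and> (\<forall>B. P S B \<longrightarrow> A \<inter> B \<noteq> {})"

text \<open>
  Names for the notions of largeness, so that one notion can be used both in \<open>int\<close> and in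
  \<open>int \<times> int\<close>.
\<close>

datatype largeness = CentralStar | IPStar | IPFinStar | IPnStar nat | DeltaStar

primrec large :: "largeness \<Rightarrow> 'a::ab_group_add set \<Rightarrow> 'a set \<Rightarrow> bool" where
  "large CentralStar = star central"
| "large IPStar = star IP_set"
| "large IPFinStar = star IP_fin_set"
| "large (IPnStar n) = star (IP_n_set n)"
| "large DeltaStar = star Delta_set"

definition large_notions :: "largeness set" where
  "large_notions = {CentralStar, IPStar, IPFinStar, DeltaStar} \<union> {IPnStar n | n. n \<ge> 2}"

definition integral_poly :: "real poly \<Rightarrow> bool" where
  "integral_poly p \<longleftrightarrow> (\<forall>k::int. poly p (of_int k) \<in> \<int>)"

definition poly_returns :: "int set \<Rightarrow> nat \<Rightarrow> (nat \<Rightarrow> real poly) \<Rightarrow> int set \<Rightarrow> (int \<times> int) set" where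
  "poly_returns R d p A =
     {(m, n) \<in> R \<times> R. \<forall>i\<in>{1..d}. of_int m + poly (p i) (of_int n) \<in> of_int ` A}"

lemma compact_metric_inj_real:
  fixes X :: "'x set"
  assumes "Metric_space X \<rho>" "compact_space (Metric_space.mtopology X \<rho>)"
  shows "\<exists>g :: 'x \<Rightarrow> real. inj_on g X"
proof -
  interpret Metric_space X \<rho> by fact
  have "mtotally_bounded X"
    using assms(2) compact_space_eq_mcomplete_mtotally_bounded by blast
  then have "\<exists>K. finite K \<and> K \<subseteq> X \<and> X \<subseteq> (\<Union>c\<in>K. mball c (1 / Suc n))" for n
    by (simp add: mtotally_bounded_def)
  then obtain K where K: "\<And>n. finite (K n)" "\<And>n. K n \<subseteq> X"
      "\<And>n. X \<subseteq> (\<Union>c\<in>K n. mball c (1 / Suc n))"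
    by metis
  define D where "D = (\<Union>n. K n)"
  have "countable D" using K(1) by (auto simp: D_def intro: countable_finite)
  define h where "h x = {(to_nat_on D c, n) | c n. c \<in> D \<and> \<rho> c x < 1 / Suc n}" for x
  have "inj_on h X"
  proof (rule inj_onI, rule ccontr)
    fix x y assume xy: "x \<in> X" "y \<in> X" "h x = h y" "x \<noteq> y"
    then have "0 < \<rho> x y / 2" by simp
    then obtain n where n: "1 / Suc n < \<rho> x y / 2"
      using nat_approx_posE by blast
    obtain c where c: "c \<in> K n" "\<rho> c x < 1 / Suc n" using K(3)[of n] xy(1) by auto
    then have cD: "c \<in> D" and cX: "c \<in> X" using K(2) by (auto simp: D_def)
    have "(to_nat_on D c, n) \<in> h x" using c cD unfolding h_def by blast
    then have "(to_nat_on D c, n) \<in> h y" using xy(3) by simp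
    then have "\<rho> c y < 1 / Suc n"
      using \<open>countable D\<close> cD by (auto simp: h_def)
    moreover have "\<rho> x y \<le> \<rho> c x + \<rho> c y" using triangle[of x c y] xy cX commute by metis
    ultimately show False using c(2) n by linarith
  qed
  moreover obtain e :: "nat set \<Rightarrow> real" where "inj e"
    using nat_sets_eqpoll_reals unfolding eqpoll_def bij_betw_def by blast
  moreover have "inj (image prod_encode)"
    by (simp add: inj_on_image inj_prod_encode)
  ultimately have "inj_on (\<lambda>x. e (prod_encode ` h x)) X"
    by (simp add: inj_on_def)
  then show ?thesis by blast
qed

lemma central_viaI:
  fixes X :: "'x set"
  assumes "A \<subseteq> S" "central_via S A X \<rho> T"
  shows "central S A"
proof -
  have ds: "dynamical_system S X \<rho> T" using assms by (simp add: central_via_def)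
  then have MX: "Metric_space X \<rho>" and cX: "compact_space (Metric_space.mtopology X \<rho>)"
    by (auto simp: dynamical_system_def)
  then obtain g :: "'x \<Rightarrow> real" where g: "inj_on g X"
    using compact_metric_inj_real by blast
  define h where "h = inv_into X g"
  define Y where "Y = g ` X"
  define \<sigma> where "\<sigma> a b = \<rho> (h a) (h b)" for a b
  define T' where "T' s = g \<circ> (T s \<circ> h)" for s
  interpret X: Metric_space X \<rho> by fact
  have hg: "h (g x) = x" if "x \<in> X" for x using that g by (simp add: h_def)
  have hY: "h a \<in> X" "g (h a) = a" if "a \<in> Y" for a
    using that by (auto simp: h_def Y_def f_inv_into_f inv_into_into)
  interpret Y: Metric_space Y \<sigma>
  proof
    show "0 \<le> \<sigma> a b" "\<sigma> a b = \<sigma> b a" for a b by (auto simp: \<sigma>_def X.commute)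
    show "(\<sigma> a b = 0) = (a = b)" if "a \<in> Y" "b \<in> Y" for a b
      using that hY X.zero unfolding \<sigma>_def by metis
    show "\<sigma> a c \<le> \<sigma> a b + \<sigma> b c" if "a \<in> Y" "b \<in> Y" "c \<in> Y" for a b c
      using that by (simp add: \<sigma>_def X.triangle hY)
  qed
  interpret XY: Metric_space12 X \<rho> Y \<sigma> ..
  have gh: "homeomorphic_map X.mtopology Y.mtopology g"
    by (rule XY.isometry_imp_homeomorphic_map) (auto simp: \<sigma>_def hg Y_def)
  interpret YX: Metric_space12 Y \<sigma> X \<rho> ..
  have hh: "homeomorphic_map Y.mtopology X.mtopology h"
    by (rule YX.isometry_imp_homeomorphic_map) (force simp: \<sigma>_def hg Y_def)+
  have cY: "compact_space Y.mtopology"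
    using homeomorphic_compact_space[OF homeomorphic_map_imp_homeomorphic_space[OF gh]] cX by simp
  have Thom: "homeomorphic_map X.mtopology X.mtopology (T s)" if "s \<in> S" for s
    using ds that by (simp add: dynamical_system_def)
  have TX: "T s x \<in> X" if "s \<in> S" "x \<in> X" for s x
    using homeomorphic_imp_surjective_map[OF Thom[OF that(1)]] that(2) by auto
  have dsY: "dynamical_system S Y \<sigma> T'"
    unfolding dynamical_system_def
  proof (intro conjI ballI)
    show "homeomorphic_map Y.mtopology Y.mtopology (T' s)" if "s \<in> S" for s
      unfolding T'_def
      by (rule homeomorphic_map_compose[OF homeomorphic_map_compose[OF hh Thom[OF that]] gh])
    show "T' (s + t) a = T' s (T' t a)" if "s \<in> S" "t \<in> S" "a \<in> Y" for s t a
    proof -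
      have "T (s + t) (h a) = T s (T t (h a))"
        using ds that(1,2) hY(1)[OF that(3)] unfolding dynamical_system_def by blast
      then show ?thesis unfolding T'_def o_def hg[OF TX[OF that(2) hY(1)[OF that(3)]]] by simp
    qed
  qed (use Y.Metric_space_axioms cY in auto)
  obtain x y U where xyU: "x \<in> X" "uniformly_recurrent S X \<rho> T y" "proximal S \<rho> T x y"
      "openin X.mtopology U" "y \<in> U" "{s \<in> S. T s x \<in> U} \<subseteq> A"
    using assms(2) unfolding central_via_def by blast
  have yX: "y \<in> X" using xyU(2) by (simp add: uniformly_recurrent_def)
  have UX: "U \<subseteq> X" using xyU(4) by (simp add: X.openin_mtopology)
  have ur: "uniformly_recurrent S Y \<sigma> T' (g y)"
    unfolding uniformly_recurrent_def
  proof (intro conjI allI impI)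
    show "g y \<in> Y" using yX by (simp add: Y_def)
    fix V assume V: "openin Y.mtopology V" "g y \<in> V"
    have VY: "V \<subseteq> Y" using V(1) by (simp add: Y.openin_mtopology)
    have "openin X.mtopology (h ` V)"
      using homeomorphic_map_openness[OF hh] V(1) VY by simp
    moreover have "y \<in> h ` V" using V(2) hg[OF yX] by force
    ultimately have syn: "syndetic S {s \<in> S. T s y \<in> h ` V}"
      using xyU(2) by (simp add: uniformly_recurrent_def)
    have hV: "z \<in> h ` V \<longleftrightarrow> g z \<in> V" if "z \<in> X" for z
      using hg[OF that] VY hY(2) by force
    have "T s y \<in> h ` V \<longleftrightarrow> T' s (g y) \<in> V" if "s \<in> S" for s
      using hV[OF TX[OF that yX]] by (simp add: T'_def hg[OF yX])
    then have "{s \<in> S. T s y \<in> h ` V} = {s \<in> S. T' s (g y) \<in> V}" by blast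
    with syn show "syndetic S {s \<in> S. T' s (g y) \<in> V}" by simp
  qed
  have pr: "proximal S \<sigma> T' (g x) (g y)"
  proof -
    obtain s :: "nat \<Rightarrow> 'a" where s: "range s \<subseteq> S"
        "(\<lambda>k. \<rho> (T (s k) x) (T (s k) y)) \<longlonglongrightarrow> 0"
      using xyU(3) unfolding proximal_def by blast
    have "\<sigma> (T' (s k) (g x)) (T' (s k) (g y)) = \<rho> (T (s k) x) (T (s k) y)" for k
    proof -
      have "s k \<in> S" using s(1) by blast
      then show ?thesis
        by (simp add: \<sigma>_def T'_def hg[OF xyU(1)] hg[OF yX] hg[OF TX] xyU(1) yX)
    qed
    then show ?thesis using s unfolding proximal_def by (intro exI[of _ s]) simp
  qed
  have op: "openin Y.mtopology (g ` U)"
    using homeomorphic_map_openness[OF gh] xyU(4) UX by simp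
  have sub: "{s \<in> S. T' s (g x) \<in> g ` U} \<subseteq> A"
  proof -
    have "T s x \<in> U" if "s \<in> S" "T' s (g x) \<in> g ` U" for s
    proof -
      have "g (T s x) \<in> g ` U" using that(2) by (simp add: T'_def hg[OF xyU(1)])
      then show ?thesis using inj_on_image_mem_iff[OF g TX[OF that(1) xyU(1)] UX] by simp
    qed
    then show ?thesis using xyU(6) by blast
  qed
  have gx: "g x \<in> Y" "g y \<in> g ` U" using xyU by (auto simp: Y_def)
  have "central_via S A Y \<sigma> T'"
    unfolding central_via_def using dsY ur pr op sub gx by blast
  then show ?thesis using \<open>A \<subseteq> S\<close> unfolding central_def by blast
qed

end

theory Submission
  imports Defs
begin

text \<open>
  Part (1): the finitely many values to be translated into \<open>A\<close> are integers, so a preliminary shift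
  makes them positive and one translation by thickness does the rest.

  Part (2): let \<open>P\<close> be one of the polynomials, of degree at least 2. If \<open>B\<close> is a set of the kind that
  large sets must meet and \<open>C = {m + P n | (m, n) \<in> B}\<close> contains no such set, then the complement of
  \<open>C\<close> is large while its set of returns misses \<open>B\<close>. In both cases below \<open>B\<close> lies in a union of
  sparse boxes inside which, by the degree assumption, the values of \<open>P\<close> are far apart.

  For all notions except centrality, \<open>B\<close> is the set of finite sums of the corners of the boxes. Then \<open>C\<close>
  contains no \<open>x, y, x + y\<close>, whereas \<open>B\<close> is an IP set, hence a \<open>\<Delta>\<close> set and (by the finite form
  of Hindman's theorem) an \<open>IP\<close> set in the finitary, partition regular sense.

  For centrality, \<open>B\<close> consists of the \<open>(m, n)\<close> in the boxes for which \<open>m\<close> is divisible by a higher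
  power of 2 than \<open>P n\<close>. This condition is uniformly recurrent, which makes \<open>B\<close> central, but
  it prevents \<open>C\<close> from containing an IP set, while every central set is one.
\<close>

section \<open>Finite unions: the finite form of Hindman's theorem\<close>

text \<open>The united sets may overlap; disjointness enters only through \<open>fin_disj\<close>,
  and it is what lets finite unions model finite sums.\<close>

inductive_set FU :: "'a set set \<Rightarrow> 'a set set" for G where
  FU_base: "g \<in> G \<Longrightarrow> g \<in> FU G"
| FU_Un: "s \<in> FU G \<Longrightarrow> t \<in> FU G \<Longrightarrow> s \<union> t \<in> FU G"

lemma FU_subset: "G \<subseteq> FU H \<Longrightarrow> FU G \<subseteq> FU H"
proof
  fix t assume G: "G \<subseteq> FU H" and "t \<in> FU G"
  from this(2) show "t \<in> FU H" by induction (use G FU_Un in auto)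
qed

lemma FU_mono: "G \<subseteq> H \<Longrightarrow> FU G \<subseteq> FU H"
  by (rule FU_subset) (auto intro: FU_base)

lemma FU_subset_Union: "t \<in> FU G \<Longrightarrow> t \<subseteq> \<Union>G"
  by (induction rule: FU.induct) auto

lemma finite_FU: "finite G \<Longrightarrow> (\<And>g. g \<in> G \<Longrightarrow> finite g) \<Longrightarrow> finite (FU G)"
  by (rule finite_subset[of _ "Pow (\<Union>G)"]) (use FU_subset_Union in \<open>blast, auto\<close>)

lemma FU_insert:
  assumes "t \<in> FU (insert a G)"
  shows "t = a \<or> t \<in> FU G \<or> (\<exists>u\<in>FU G. t = a \<union> u)"
  using assms
proof induction
  case (FU_base g)
  then show ?case by (auto intro: FU.FU_base)
next
  case (FU_Un s t)
  \<comment> \<open>Adjoining the empty set merges \<open>t = a\<close> and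
    \<open>t = a \<union> u\<close> into one alternative, and \<open>W\<close> is still closed under
    unions.\<close>
  define W where "W = {{}} \<union> FU G"
  have W: "v = a \<or> v \<in> FU G \<or> (\<exists>u\<in>FU G. v = a \<union> u) \<longleftrightarrow> v \<in> FU G \<or> (\<exists>u\<in>W. v = a \<union> u)" for v
    by (auto simp: W_def)
  have WW: "u \<union> v \<in> W" if "u \<in> W" "v \<in> W" for u v
    using that FU.FU_Un by (auto simp: W_def)
  have FW: "u \<in> W" if "u \<in> FU G" for u using that by (simp add: W_def)
  consider "s \<in> FU G" "t \<in> FU G" | u where "u \<in> W" "s = a \<union> u" "t \<in> FU G"
    | u where "u \<in> W" "t = a \<union> u" "s \<in> FU G"
    | u v where "u \<in> W" "s = a \<union> u" "v \<in> W" "t = a \<union> v"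
    using FU_Un.IH unfolding W by (elim disjE bexE) simp_all
  then show ?case
  proof cases
    case 1
    then show ?thesis using FU.FU_Un[OF 1] by simp
  next
    case (2 u)
    then show ?thesis unfolding W using WW[OF 2(1) FW[OF 2(3)]] by (intro disjI2 bexI[of _ "u \<union> t"]) auto
  next
    case (3 u)
    then show ?thesis unfolding W using WW[OF 3(1) FW[OF 3(3)]] by (intro disjI2 bexI[of _ "u \<union> s"]) auto
  next
    case (4 u v)
    then show ?thesis unfolding W using WW[OF 4(1,3)] by (intro disjI2 bexI[of _ "u \<union> v"]) auto
  qed
qed

lemma FU_UNION:
  assumes "finite \<alpha>" "\<alpha> \<noteq> {}" "\<alpha> \<subseteq> I"
  shows "(\<Union>i\<in>\<alpha>. y i) \<in> FU (y ` I)"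
  using assms
proof (induction rule: finite_ne_induct)
  case (insert i \<alpha>)
  then show ?case by (simp add: FU_Un FU_base)
qed (simp add: FU_base)

lemma FU_range:
  fixes d :: "nat \<Rightarrow> 'a set"
  assumes "t \<in> FU (range d)"
  shows "\<exists>k. t \<in> FU (d ` {..<k})"
  using assms
proof induction
  case (FU_base g)
  then obtain i where "g = d i" by auto
  then show ?case by (intro exI[of _ "Suc i"] FU.FU_base) auto
next
  case (FU_Un s t)
  then obtain k l where "s \<in> FU (d ` {..<k})" "t \<in> FU (d ` {..<l})" by blast
  moreover have "FU (d ` {..<k}) \<subseteq> FU (d ` {..<max k l})" "FU (d ` {..<l}) \<subseteq> FU (d ` {..<max k l})"
    by (intro FU_mono image_mono; simp)+
  ultimately show ?case by (intro exI[of _ "max k l"] FU.FU_Un) auto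
qed

section \<open>Largeness relative to a disjoint family of finite sets\<close>

definition fin_disj :: "(nat \<Rightarrow> 'a set) \<Rightarrow> bool" where
  "fin_disj D \<longleftrightarrow> (\<forall>i. finite (D i) \<and> D i \<noteq> {}) \<and> disjoint_family D"

definition coarser :: "(nat \<Rightarrow> 'a set) \<Rightarrow> (nat \<Rightarrow> 'a set) \<Rightarrow> bool" where
  "coarser D' D \<longleftrightarrow> fin_disj D' \<and> range D' \<subseteq> FU (range D)"

text \<open>The notion behind Baumgartner's proof of Hindman's theorem. If it fails, some coarser
  family has all its finite unions outside \<open>X\<close>, and one can pass to that
  family.\<close>

definition large_for :: "'a set set \<Rightarrow> (nat \<Rightarrow> 'a set) \<Rightarrow> bool" where
  "large_for X D \<longleftrightarrow> (\<forall>D'. coarser D' D \<longrightarrow> FU (range D') \<inter> X \<noteq> {})"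

lemma coarser_FU: "coarser D' D \<Longrightarrow> FU (range D') \<subseteq> FU (range D)"
  unfolding coarser_def using FU_subset by blast

lemma coarser_trans: "coarser D'' D' \<Longrightarrow> coarser D' D \<Longrightarrow> coarser D'' D"
  using coarser_FU[of D' D] unfolding coarser_def by (meson order_trans)

lemma coarser_refl: "fin_disj D \<Longrightarrow> coarser D D"
  unfolding coarser_def by (blast intro: FU_base)

lemma large_for_coarser: "large_for X D \<Longrightarrow> coarser D' D \<Longrightarrow> large_for X D'"
  unfolding large_for_def using coarser_trans[of _ D' D] by simp

lemma large_for_mono: "large_for X D \<Longrightarrow> X \<subseteq> Y \<Longrightarrow> large_for Y D"
  unfolding large_for_def by (metis Int_mono order_refl subset_empty)

lemma large_for_UNIV: "large_for UNIV D"
proof -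
  have "D' 0 \<in> FU (range D')" for D' :: "nat \<Rightarrow> 'a set" by (simp add: FU_base)
  then show ?thesis unfolding large_for_def by (metis Int_UNIV_right empty_iff)
qed

lemma FU_finite_nonempty: "fin_disj D \<Longrightarrow> t \<in> FU (range D) \<Longrightarrow> finite t \<and> t \<noteq> {}"
proof -
  assume D: "fin_disj D" and "t \<in> FU (range D)"
  from this(2) show ?thesis by induction (use D in \<open>auto simp: fin_disj_def\<close>)
qed

text \<open>Remove the pieces one at a time: if \<open>Y e\<close> is not large for the current
  family, a coarser family avoids \<open>Y e\<close> altogether, and the remaining pieces cover its
  part of \<open>X\<close>.\<close>

lemma large_for_finite_cover:
  assumes "finite I" "fin_disj D" "large_for X D" "X \<inter> FU (range D) \<subseteq> (\<Union>d\<in>I. Y d)"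
  shows "\<exists>d\<in>I. \<exists>D'. coarser D' D \<and> large_for (Y d) D'"
  using assms
proof (induction I arbitrary: D rule: finite_induct)
  case empty
  then have "FU (range D) \<inter> X \<noteq> {}" using coarser_refl unfolding large_for_def by blast
  then show ?case using empty.prems(3) by simp blast
next
  case (insert e I)
  show ?case
  proof (cases "large_for (Y e) D")
    case True
    then show ?thesis using coarser_refl[OF insert.prems(1)] by (intro bexI[of _ e] exI[of _ D]) auto
  next
    case False
    then obtain D' where D': "coarser D' D" "FU (range D') \<inter> Y e = {}"
      by (auto simp: large_for_def)
    have "X \<inter> FU (range D') \<subseteq> (\<Union>d\<in>I. Y d)"
      using insert.prems(3) D' coarser_FU[OF D'(1)] by blast
    moreover have "fin_disj D'" "large_for X D'"
      using D'(1) insert.prems(2) large_for_coarser by (auto simp: coarser_def)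
    ultimately obtain d D'' where "d \<in> I" "coarser D'' D'" "large_for (Y d) D''"
      using insert.IH by blast
    then show ?thesis using coarser_trans[OF _ D'(1)] by (intro bexI[of _ d] exI[of _ D'']) auto
  qed
qed

text \<open>If no finite \<open>E\<close> worked, one could choose recursively sets
  \<open>s n\<close>, disjoint from their predecessors, such that \<open>s n \<union> d\<close> is
  outside \<open>X\<close> for every finite union \<open>d\<close> of predecessors. Pairing them
  gives a coarser family that contradicts largeness.\<close>

lemma large_for_finite_syndetic:
  assumes D: "fin_disj D" and X: "large_for X D"
  shows "\<exists>E. finite E \<and> E \<subseteq> FU (range D) \<and>
    (\<forall>s\<in>FU (range D). s \<inter> \<Union>E = {} \<longrightarrow> (\<exists>d\<in>FU E. s \<union> d \<in> X))"
proof (rule ccontr)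
  assume neg: "\<not> ?thesis"
  have "\<exists>s. finite E \<longrightarrow> E \<subseteq> FU (range D) \<longrightarrow>
      s \<in> FU (range D) \<and> s \<inter> \<Union>E = {} \<and> (\<forall>d\<in>FU E. s \<union> d \<notin> X)" for E
  proof (cases "finite E \<and> E \<subseteq> FU (range D)")
    case True
    then have "\<not> (\<forall>s\<in>FU (range D). s \<inter> \<Union>E = {} \<longrightarrow> (\<exists>d\<in>FU E. s \<union> d \<in> X))"
      using neg by simp
    then show ?thesis by auto
  qed auto
  then obtain h where h: "\<And>E. finite E \<Longrightarrow> E \<subseteq> FU (range D) \<Longrightarrow>
      h E \<in> FU (range D) \<and> h E \<inter> \<Union>E = {} \<and> (\<forall>d\<in>FU E. h E \<union> d \<notin> X)"
    by metis
  define G where "G = rec_nat {} (\<lambda>_ E. insert (h E) E)"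
  have G0: "G 0 = {}" and GS: "G (Suc n) = insert (h (G n)) (G n)" for n
    by (simp_all add: G_def)
  define s where "s n = h (G n)" for n
  have G: "finite (G n) \<and> G n \<subseteq> FU (range D)" for n
    by (induction n) (use h in \<open>auto simp: G0 GS\<close>)
  have Geq: "G n = s ` {..<n}" for n
    by (induction n) (auto simp: G0 GS s_def lessThan_Suc)
  have "s n \<in> FU (range D) \<and> s n \<inter> \<Union>(G n) = {} \<and> (\<forall>d\<in>FU (G n). s n \<union> d \<notin> X)" for n
    unfolding s_def using h[of "G n"] G[of n] by simp
  then have hs: "s n \<in> FU (range D) \<and> s n \<inter> \<Union>(s ` {..<n}) = {} \<and> (\<forall>d\<in>FU (s ` {..<n}). s n \<union> d \<notin> X)" for n
    unfolding Geq .
  then have s': "s n \<in> FU (range D)" and sX: "d \<in> FU (s ` {..<n}) \<Longrightarrow> s n \<union> d \<notin> X" for n d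
    by simp_all
  have s: "s n \<inter> s i = {}" if "i < n" for n i using hs[of n] that by blast
  have sd: "s n \<inter> s i = {}" if "i \<noteq> n" for n i
    using s[of i n] s[of n i] that by (metis Int_commute linorder_neqE_nat)
  \<comment> \<open>Nothing is known about a single \<open>s n\<close>. With pairs, the last set in
    any finite union is always joined to a union of earlier ones.\<close>
  define D' where "D' j = s (2 * j) \<union> s (Suc (2 * j))" for j
  have "disjoint_family D'"
    unfolding disjoint_family_on_def D'_def
  proof (intro ballI impI)
    fix m n :: nat assume "m \<noteq> n"
    then have "2 * m \<noteq> 2 * n" "2 * m \<noteq> Suc (2 * n)" "Suc (2 * m) \<noteq> 2 * n" "Suc (2 * m) \<noteq> Suc (2 * n)"
      by presburger+
    then show "(s (2 * m) \<union> s (Suc (2 * m))) \<inter> (s (2 * n) \<union> s (Suc (2 * n))) = {}"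
      using sd by (simp add: Int_Un_distrib Int_Un_distrib2)
  qed
  moreover have "finite (D' j) \<and> D' j \<noteq> {}" for j
    using FU_finite_nonempty[OF D s'] by (simp add: D'_def)
  ultimately have "coarser D' D"
    unfolding coarser_def fin_disj_def using FU_Un[OF s' s'] by (simp add: D'_def image_subset_iff)
  then have "FU (range D') \<inter> X \<noteq> {}" using X by (simp add: large_for_def)
  then obtain t where t: "t \<in> FU (range D')" "t \<in> X" by blast
  have "\<exists>k. \<exists>d\<in>FU (s ` {..<Suc k}). t = s (Suc k) \<union> d"
    using t(1)
  proof induction
    case (FU_base g)
    then obtain j where j: "g = s (Suc (2 * j)) \<union> s (2 * j)" by (auto simp: D'_def)
    moreover have "s (2 * j) \<in> FU (s ` {..<Suc (2 * j)})" by (rule FU.FU_base) simp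
    ultimately show ?case by blast
  next
    case (FU_Un t u)
    have wlog: "\<exists>k. \<exists>d\<in>FU (s ` {..<Suc k}). t \<union> u = s (Suc k) \<union> d"
      if tu: "d \<in> FU (s ` {..<Suc k})" "t = s (Suc k) \<union> d"
        "e \<in> FU (s ` {..<Suc l})" "u = s (Suc l) \<union> e" and kl: "k \<le> l" for t u d e k l
    proof (cases "k = l")
      case True
      then have "t \<union> u = s (Suc l) \<union> (d \<union> e)" "d \<union> e \<in> FU (s ` {..<Suc l})"
        using tu True FU.FU_Un by auto
      then show ?thesis by blast
    next
      case False
      have "s (Suc k) \<in> FU (s ` {..<Suc l})" by (rule FU.FU_base) (use False kl in auto)
      moreover have "d \<in> FU (s ` {..<Suc l})"
        by (rule subsetD[OF FU_mono tu(1)]) (use kl in auto)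
      ultimately have "s (Suc k) \<union> d \<union> e \<in> FU (s ` {..<Suc l})" using tu by (intro FU.FU_Un)
      moreover have "t \<union> u = s (Suc l) \<union> (s (Suc k) \<union> d \<union> e)" using tu by auto
      ultimately show ?thesis by blast
    qed
    from FU_Un.IH obtain k d l e where *: "d \<in> FU (s ` {..<Suc k})" "t = s (Suc k) \<union> d"
        "e \<in> FU (s ` {..<Suc l})" "u = s (Suc l) \<union> e" by blast
    then show ?case using wlog[OF *] wlog[OF *(3,4,1,2)] by (metis Un_commute linear)
  qed
  then show False using sX t(2) by blast
qed

text \<open>Past the finitely many members that meet \<open>\<Union>E\<close>, each element of
  \<open>X\<close> is sent back into \<open>X\<close> by some \<open>d\<close> in the finite set
  \<open>FU E\<close>. The sets of \<open>s\<close> belonging to the various \<open>d\<close> form a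
  finite cover, so one of them is large for a coarser family.\<close>

lemma large_for_translate:
  assumes D: "fin_disj D" and X: "large_for X D"
  shows "\<exists>d\<in>FU (range D). \<exists>D'. coarser D' D \<and> (\<forall>u\<in>FU (range D'). u \<inter> d = {}) \<and>
    large_for {s \<in> X. s \<union> d \<in> X} D'"
proof -
  obtain E where E: "finite E" "E \<subseteq> FU (range D)"
    "\<forall>s\<in>FU (range D). s \<inter> \<Union>E = {} \<longrightarrow> (\<exists>d\<in>FU E. s \<union> d \<in> X)"
    using large_for_finite_syndetic[OF D X] by (elim exE conjE)
  have finE: "finite g" if "g \<in> E" for g using FU_finite_nonempty[OF D subsetD[OF E(2) that]] by simp
  have "finite (\<Union>E)" using E(1) finE by blast
  have "finite {i. D i \<inter> \<Union>E \<noteq> {}}"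
  proof (rule inj_on_finite)
    define f where "f i = (SOME a. a \<in> D i \<inter> \<Union>E)" for i
    have f: "f i \<in> D i \<inter> \<Union>E" if "D i \<inter> \<Union>E \<noteq> {}" for i
      unfolding f_def by (rule someI_ex) (use that in blast)
    show "f ` {i. D i \<inter> \<Union>E \<noteq> {}} \<subseteq> \<Union>E" using f by blast
    show "inj_on f {i. D i \<inter> \<Union>E \<noteq> {}}"
    proof (rule inj_onI, rule ccontr)
      fix i j assume ij: "i \<in> {i. D i \<inter> \<Union>E \<noteq> {}}" "j \<in> {i. D i \<inter> \<Union>E \<noteq> {}}" "f i = f j" "i \<noteq> j"
      then have "f i \<in> D i \<inter> D j" using f[of i] f[of j] by auto
      then show False using D ij(4) by (auto simp: fin_disj_def disjoint_family_on_def)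
    qed
  qed fact
  from finite_nat_bounded[OF this] obtain i0 where "{i. D i \<inter> \<Union>E \<noteq> {}} \<subseteq> {..<i0}" ..
  then have i0: "i < i0" if "D i \<inter> \<Union>E \<noteq> {}" for i
    using that by blast
  define D1 where "D1 i = D (i + i0)" for i
  have D1: "fin_disj D1" using D by (auto simp: fin_disj_def D1_def disjoint_family_on_def)
  have cD1: "coarser D1 D" using D1 by (auto simp: coarser_def D1_def FU_base)
  have "D1 i \<inter> \<Union>E = {}" for i using i0[of "i + i0"] by (auto simp: D1_def)
  then have disj: "u \<inter> \<Union>E = {}" if "u \<in> FU (range D1)" for u using FU_subset_Union[OF that] by blast
  have "X \<inter> FU (range D1) \<subseteq> (\<Union>d\<in>FU E. {s \<in> X. s \<union> d \<in> X})"
    using E(3) disj subsetD[OF coarser_FU[OF cD1]] by auto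
  from large_for_finite_cover[OF finite_FU[OF E(1)] D1 large_for_coarser[OF X cD1] this] finE
  obtain d D' where d: "d \<in> FU E" "coarser D' D1" "large_for {s \<in> X. s \<union> d \<in> X} D'"
    by auto
  have "u \<inter> d = {}" if "u \<in> FU (range D')" for u
    using disj[OF subsetD[OF coarser_FU[OF d(2)] that]] FU_subset_Union[OF d(1)] by blast
  moreover have "d \<in> FU (range D)" using subsetD[OF FU_subset[OF E(2)] d(1)] .
  ultimately show ?thesis
    using d(3) coarser_trans[OF d(2) cD1] by (intro bexI[of _ d] exI[of _ D']) simp_all
qed

text \<open>The translating set must now itself lie in \<open>X\<close>. Iterating
  \<open>large_for_translate\<close> gives disjoint sets \<open>d n\<close>; they form a coarser
  family, so some finite union \<open>t\<close> of them lies in \<open>X\<close>, and this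
  \<open>t\<close> is taken.\<close>

lemma large_for_translate_mem:
  fixes D :: "nat \<Rightarrow> 'a set"
  assumes D: "fin_disj D" and X: "large_for X D"
  shows "\<exists>d\<in>X \<inter> FU (range D). \<exists>D'. coarser D' D \<and> (\<forall>u\<in>FU (range D'). u \<inter> d = {}) \<and>
    large_for {s \<in> X. s \<union> d \<in> X} D'"
proof -
  define good where "good Z d D' \<longleftrightarrow> d \<in> FU (range (snd Z)) \<and> coarser D' (snd Z) \<and>
     (\<forall>u\<in>FU (range D'). u \<inter> d = {}) \<and> large_for {s \<in> fst Z. s \<union> d \<in> fst Z} D'"
    for Z :: "'a set set \<times> (nat \<Rightarrow> 'a set)" and d D'
  have "\<exists>d D'. good Z d D'" if "fin_disj (snd Z)" "large_for (fst Z) (snd Z)" for Z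
    using large_for_translate[OF that] unfolding good_def by auto
  then obtain h g where "\<And>Z. fin_disj (snd Z) \<Longrightarrow> large_for (fst Z) (snd Z) \<Longrightarrow> good Z (h Z) (g Z)"
    by metis
  note hg = this[unfolded good_def]
  define Z where "Z = rec_nat (X, D) (\<lambda>_ Z. ({s \<in> fst Z. s \<union> h Z \<in> fst Z}, g Z))"
  have Z0: "Z 0 = (X, D)" and ZS: "Z (Suc n) = ({s \<in> fst (Z n). s \<union> h (Z n) \<in> fst (Z n)}, g (Z n))" for n
    by (simp_all add: Z_def)
  have inv: "fin_disj (snd (Z n)) \<and> large_for (fst (Z n)) (snd (Z n))" for n
  proof (induction n)
    case (Suc n)
    then show ?case using hg[of "Z n"] by (simp add: ZS coarser_def)
  qed (simp add: Z0 D X)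
  define d where "d n = h (Z n)" for n
  have step: "d n \<in> FU (range (snd (Z n)))" "coarser (snd (Z (Suc n))) (snd (Z n))"
    "\<And>u. u \<in> FU (range (snd (Z (Suc n)))) \<Longrightarrow> u \<inter> d n = {}"
    "fst (Z (Suc n)) = {s \<in> fst (Z n). s \<union> d n \<in> fst (Z n)}" for n
    using hg[of "Z n"] inv[of n] by (auto simp: ZS d_def)
  have co: "coarser (snd (Z m)) (snd (Z n))" if "n \<le> m" for m n
    using that
  proof (induction m rule: dec_induct)
    case base
    then show ?case using coarser_refl[OF conjunct1[OF inv]] by simp
  next
    case (step m)
    then show ?case using coarser_trans[OF \<open>\<And>n. coarser (snd (Z (Suc n))) (snd (Z n))\<close>] by simp
  qed
  have disj: "u \<inter> d j = {}" if "u \<in> FU (range (snd (Z n)))" "j < n" for u j n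
    using step(3)[OF subsetD[OF coarser_FU[OF co[of "Suc j" n]]]] that by simp
  have dd: "d n \<inter> d j = {}" if "j < n" for n j using disj[OF step(1) that] .
  have dD: "d n \<in> FU (range D)" for n using subsetD[OF coarser_FU[OF co[of 0 n]] step(1)[of n]] by (simp add: Z0)
  have "disjoint_family d"
    unfolding disjoint_family_on_def using dd by (metis Int_commute linorder_neqE_nat)
  then have "coarser d D"
    using dD FU_finite_nonempty[OF D dD] by (simp add: coarser_def fin_disj_def image_subset_iff)
  then have "FU (range d) \<inter> X \<noteq> {}" using X by (simp add: large_for_def)
  then obtain t where t: "t \<in> FU (range d)" "t \<in> X" by blast
  have sub: "fst (Z k) \<subseteq> X" for k
  proof (induction k)
    case (Suc k)
    then show ?case unfolding step(4) by blast
  qed (simp add: Z0)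
  \<comment> \<open>Peel off the latest piece: both \<open>s\<close> and
    \<open>s \<union> d k\<close> lie in the previous stage, where the induction handles the earlier
    pieces.\<close>
  have key: "s \<union> t \<in> X" if "t \<in> FU (d ` {..<k})" "s \<in> fst (Z k)" for s t k
    using that
  proof (induction k arbitrary: s t)
    case 0
    have "u \<notin> FU {}" for u :: "'a set"
    proof
      assume "u \<in> FU {}" then show False by induction auto
    qed
    then show ?case using 0 by simp
  next
    case (Suc k)
    have s: "s \<in> fst (Z k)" "s \<union> d k \<in> fst (Z k)" using Suc.prems(2) unfolding step(4) by simp_all
    have "t = d k \<or> t \<in> FU (d ` {..<k}) \<or> (\<exists>u\<in>FU (d ` {..<k}). t = d k \<union> u)"
      using Suc.prems(1) FU_insert[of t "d k"] by (simp add: lessThan_Suc)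
    then show ?case
    proof (elim disjE bexE)
      assume "t = d k"
      then show ?thesis using s(2) sub[of k] by auto
    next
      assume "t \<in> FU (d ` {..<k})"
      then show ?thesis using Suc.IH s(1) by simp
    next
      fix u assume "u \<in> FU (d ` {..<k})" "t = d k \<union> u"
      then show ?thesis using Suc.IH[OF _ s(2), of u] by (simp add: Un_assoc)
    qed
  qed
  obtain k where k: "t \<in> FU (d ` {..<k})" using FU_range[OF t(1)] by (elim exE)
  have "fst (Z k) \<subseteq> {s \<in> X. s \<union> t \<in> X}"
    using key[OF k] sub[of k] by (auto simp: subset_iff)
  from large_for_mono[OF conjunct2[OF inv] this]
  have "large_for {s \<in> X. s \<union> t \<in> X} (snd (Z k))" .
  moreover have "u \<inter> t = {}" if "u \<in> FU (range (snd (Z k)))" for u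
    using FU_subset_Union[OF k] disj[OF that] by blast
  moreover have "t \<in> FU (range D)"
    by (rule subsetD[OF FU_subset t(1)]) (use dD in auto)
  ultimately show ?thesis
    using t(2) co[of 0 k] Z0 by (intro bexI[of _ t] exI[of _ "snd (Z k)"]) simp_all
qed

text \<open>Once \<open>d \<in> X\<close> is fixed, induction is applied to the set of
  \<open>s \<in> X\<close> with \<open>s \<union> d \<in> X\<close>; this takes care of unions with
  and without \<open>d\<close>.\<close>

lemma large_for_FU:
  fixes n :: nat and D :: "nat \<Rightarrow> 'a set"
  assumes "fin_disj D" "large_for X D"
  shows "\<exists>y. y ` {1..n} \<subseteq> FU (range D) \<and> disjoint_family_on y {1..n} \<and> FU (y ` {1..n}) \<subseteq> X"
  using assms
proof (induction n arbitrary: X D)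
  case 0
  have "u \<notin> FU {}" for u :: "'a set"
  proof
    assume "u \<in> FU {}" then show False by induction auto
  qed
  then show ?case by (auto simp: disjoint_family_on_def)
next
  case (Suc n)
  obtain d D' where d: "d \<in> X" "d \<in> FU (range D)" "coarser D' D" "\<And>u. u \<in> FU (range D') \<Longrightarrow> u \<inter> d = {}"
    "large_for {s \<in> X. s \<union> d \<in> X} D'" using large_for_translate_mem[OF Suc.prems] by auto
  have D': "fin_disj D'" using d(3) by (simp add: coarser_def)
  obtain y where y: "y ` {1..n} \<subseteq> FU (range D')" "disjoint_family_on y {1..n}"
    "FU (y ` {1..n}) \<subseteq> {s \<in> X. s \<union> d \<in> X}" using Suc.IH[OF D' d(5)] by (elim exE conjE)
  define z where "z = y(Suc n := d)"
  have zim: "z ` {1..Suc n} = insert d (y ` {1..n})"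
  proof -
    have "z ` {1..n} = y ` {1..n}" by (rule image_cong) (auto simp: z_def)
    then show ?thesis by (simp add: atLeastAtMostSuc_conv) (simp add: z_def)
  qed
  have "z ` {1..Suc n} \<subseteq> FU (range D)" unfolding zim using order_trans[OF y(1) coarser_FU[OF d(3)]] d(2) by simp
  moreover have "disjoint_family_on z {1..Suc n}"
  proof -
    have "disjoint_family_on z {1..n} \<longleftrightarrow> disjoint_family_on y {1..n}"
      by (simp add: disjoint_family_on_def z_def)
    moreover have "z (Suc n) \<inter> (\<Union>i\<in>{1..n}. z i) = {}"
    proof -
      have "y i \<inter> d = {}" if "i \<in> {1..n}" for i using d(4)[OF subsetD[OF y(1) imageI[OF that]]] .
      then show ?thesis by (simp add: z_def Int_commute disjoint_iff)
    qed
    ultimately show ?thesis using y(2) by (simp add: atLeastAtMostSuc_conv disjoint_family_on_insert)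
  qed
  moreover have "FU (z ` {1..Suc n}) \<subseteq> X"
  proof
    fix t assume "t \<in> FU (z ` {1..Suc n})"
    from FU_insert[OF this[unfolded zim]] show "t \<in> X"
      using subsetD[OF y(3)] d(1) by (elim disjE bexE) (simp_all add: Un_commute)
  qed
  ultimately show ?case by (intro exI[of _ z] conjI)
qed

section \<open>Transfer from finite unions to finite sums\<close>

lemma sum_closed:
  fixes S :: "'a::ab_group_add set"
  assumes "\<And>s t. s \<in> S \<Longrightarrow> t \<in> S \<Longrightarrow> s + t \<in> S" "finite \<alpha>" "\<alpha> \<noteq> {}" "\<And>i. i \<in> \<alpha> \<Longrightarrow> x i \<in> S"
  shows "sum x \<alpha> \<in> S"
  using assms(2-) by (induction rule: finite_ne_induct) (auto simp: assms(1))

text \<open>A partition of the sums colours the finite index sets, and one colour is large for some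
  family coarser than the singletons. Disjoint index sets whose unions all have that colour then
  provide the summands.\<close>

lemma IP_fin_set_FS:
  fixes S :: "'a::ab_group_add set"
  assumes S: "\<And>s t. s \<in> S \<Longrightarrow> t \<in> S \<Longrightarrow> s + t \<in> S" and x: "range x \<subseteq> S"
  shows "IP_fin_set S (FS (UNIV :: nat set) x)"
  unfolding IP_fin_set_def
proof (intro conjI allI impI)
  have xS: "sum x t \<in> S" if "finite t" "t \<noteq> {}" for t
    by (rule sum_closed[OF S that]) (use x in auto)
  then show "FS UNIV x \<subseteq> S" by (auto simp: FS_def)
  fix P and n :: nat assume P: "finite P" "partition_on (FS UNIV x) P"
  define Y where "Y c = {t. finite t \<and> t \<noteq> {} \<and> sum x t \<in> c}" for c
  define D where "D i = {i}" for i :: nat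
  have D: "fin_disj D" by (auto simp: D_def fin_disj_def disjoint_family_on_def)
  have "t \<in> (\<Union>c\<in>P. Y c)" if "t \<in> FU (range D)" for t
  proof -
    have t: "finite t" "t \<noteq> {}" using FU_finite_nonempty[OF D that] by auto
    then have "sum x t \<in> FS UNIV x" by (auto simp: FS_def)
    then show ?thesis using t P(2) by (auto simp: partition_on_def Y_def)
  qed
  then obtain c D' where c: "c \<in> P" "coarser D' D" "large_for (Y c) D'"
    using large_for_finite_cover[OF P(1) D large_for_UNIV, of Y] by (auto simp: subset_iff)
  then have D': "fin_disj D'" by (simp add: coarser_def)
  obtain y where y: "y ` {1..n} \<subseteq> FU (range D')" "disjoint_family_on y {1..n}"
    "FU (y ` {1..n}) \<subseteq> Y c" using large_for_FU[OF D' c(3), of n] by (elim exE conjE)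
  define z where "z i = sum x (y i)" for i
  have yfin: "finite (y i)" "y i \<noteq> {}" if "i \<in> {1..n}" for i
    using FU_finite_nonempty[OF D', of "y i"] y(1) that by (simp_all add: image_subset_iff)
  have "z ` {1..n} \<subseteq> S" using xS yfin by (simp add: z_def image_subset_iff)
  moreover have "FS {1..n} z \<subseteq> c"
  proof
    fix a assume "a \<in> FS {1..n} z"
    then obtain \<alpha> where \<alpha>: "finite \<alpha>" "\<alpha> \<noteq> {}" "\<alpha> \<subseteq> {1..n}" "a = sum z \<alpha>" by (auto simp: FS_def)
    have "a = sum x (\<Union>i\<in>\<alpha>. y i)"
      unfolding \<alpha>(4) z_def using \<alpha> yfin y(2)
      by (subst sum.UNION_disjoint) (auto simp: disjoint_family_on_def subset_iff)
    moreover have "(\<Union>i\<in>\<alpha>. y i) \<in> Y c" using FU_UNION[OF \<alpha>(1,2,3)] y(3) by blast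
    ultimately show "a \<in> c" by (simp add: Y_def)
  qed
  ultimately show "\<exists>F\<in>P. \<exists>x. x ` {1..n} \<subseteq> S \<and> FS {1..n} x \<subseteq> F" using c(1) by blast
qed

section \<open>Central sets\<close>

lemma syndetic_mono: "syndetic S A \<Longrightarrow> A \<subseteq> B \<Longrightarrow> B \<subseteq> S \<Longrightarrow> syndetic S B"
  unfolding syndetic_def
proof (elim conjE exE, intro conjI)
  fix F assume AB: "A \<subseteq> B" and F: "finite F" "F \<subseteq> S" and eq: "S = (\<Union>s\<in>F. {y \<in> S. s + y \<in> A})"
  have "x \<in> (\<Union>s\<in>F. {y \<in> S. s + y \<in> B})" if "x \<in> S" for x
    using subsetD[OF equalityD1[OF eq] that] AB by blast
  then have "S = (\<Union>s\<in>F. {y \<in> S. s + y \<in> B})" by (intro equalityI subsetI) blast+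
  then show "\<exists>F. finite F \<and> F \<subseteq> S \<and> S = (\<Union>s\<in>F. {y \<in> S. s + y \<in> B})" using F by (intro exI conjI)
qed

text \<open>Compactness makes \<open>T s\<close> uniformly continuous. Hence proximality survives
  the finitely many translations that syndeticity supplies.\<close>

lemma dynamical_system_uniformly_continuous:
  assumes "dynamical_system S X \<rho> T" "s \<in> S" "range u \<subseteq> X" "range v \<subseteq> X"
    "(\<lambda>k. \<rho> (u k) (v k)) \<longlonglongrightarrow> 0"
  shows "(\<lambda>k. \<rho> (T s (u k)) (T s (v k))) \<longlonglongrightarrow> 0"
proof -
  interpret Metric_space X \<rho> using assms(1) by (simp add: dynamical_system_def)
  have [simp]: "mspace (metric (X, \<rho>)) = X" "mdist (metric (X, \<rho>)) = \<rho>"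
    by (simp_all add: mspace_metric mdist_metric)
  have top: "mtopology_of (metric (X, \<rho>)) = mtopology" by (simp add: mtopology_of_def)
  have "uniformly_continuous_map (metric (X, \<rho>)) (metric (X, \<rho>)) (T s)"
    by (rule continuous_imp_uniformly_continuous_map, unfold top)
      (use assms(1,2) in \<open>auto simp: dynamical_system_def intro: homeomorphic_imp_continuous_map\<close>)
  then show ?thesis using assms(3-) unfolding uniformly_continuous_map_sequentially by auto
qed

text \<open>For suitable \<open>k\<close>, the images of \<open>x\<close> and \<open>y\<close> under
  \<open>s k\<close> followed by any \<open>f\<close> of the finite syndeticity set are within
  \<open>e / 2\<close> of each other; one such \<open>f\<close> returns \<open>y\<close> to the ball
  of radius \<open>e / 2\<close>.\<close>

lemma proximal_common_return:
  assumes DS: "dynamical_system S X \<rho> T" and S: "\<And>s t. s \<in> S \<Longrightarrow> t \<in> S \<Longrightarrow> s + t \<in> S"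
    and x: "x \<in> X" and y: "uniformly_recurrent S X \<rho> T y" and xy: "proximal S \<rho> T x y"
    and V: "openin (Metric_space.mtopology X \<rho>) V" "y \<in> V"
  shows "\<exists>s\<in>S. T s x \<in> V \<and> T s y \<in> V"
proof -
  interpret Metric_space X \<rho> using DS by (simp add: dynamical_system_def)
  have TX: "T s z \<in> X" if "s \<in> S" "z \<in> X" for s z
  proof -
    have "homeomorphic_map mtopology mtopology (T s)" using DS that by (simp add: dynamical_system_def)
    then show ?thesis using homeomorphic_imp_surjective_map that(2) by fastforce
  qed
  have yX: "y \<in> X" using y by (simp add: uniformly_recurrent_def)
  obtain e where e: "e > 0" "mball y e \<subseteq> V" using V by (auto simp: openin_mtopology)
  define W where "W = mball y (e / 2)"
  have "openin mtopology W" "y \<in> W" using e yX by (auto simp: W_def)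
  then have "syndetic S {s \<in> S. T s y \<in> W}" using y by (simp add: uniformly_recurrent_def)
  then obtain F where F: "finite F" "F \<subseteq> S" "S = (\<Union>s\<in>F. {t \<in> S. s + t \<in> {s \<in> S. T s y \<in> W}})"
    unfolding syndetic_def by (elim conjE exE)
  obtain s where s: "range s \<subseteq> S" "(\<lambda>k. \<rho> (T (s k) x) (T (s k) y)) \<longlonglongrightarrow> 0"
    using xy unfolding proximal_def by (elim exE conjE)
  have sS: "s k \<in> S" for k using s(1) by auto
  have "\<forall>\<^sub>F k in sequentially. \<rho> (T f (T (s k) x)) (T f (T (s k) y)) < e / 2" if "f \<in> F" for f
  proof -
    have "(\<lambda>k. \<rho> (T f (T (s k) x)) (T f (T (s k) y))) \<longlonglongrightarrow> 0"
      by (rule dynamical_system_uniformly_continuous[OF DS _ _ _ s(2)]) (use F(2) that TX x yX sS in auto)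
    then show ?thesis by (rule order_tendstoD(2)) (use e in simp)
  qed
  then have "\<forall>\<^sub>F k in sequentially. \<forall>f\<in>F. \<rho> (T f (T (s k) x)) (T f (T (s k) y)) < e / 2"
    using F(1) by (simp add: eventually_ball_finite)
  then obtain k where k: "\<And>f. f \<in> F \<Longrightarrow> \<rho> (T f (T (s k) x)) (T f (T (s k) y)) < e / 2"
    unfolding eventually_sequentially by auto
  obtain f where f: "f \<in> F" "T (f + s k) y \<in> W" using F(3) sS[of k] by blast
  have fS: "f \<in> S" using f(1) F(2) by auto
  have Tadd: "T (f + s k) z = T f (T (s k) z)" if "z \<in> X" for z
    using DS fS sS that by (simp add: dynamical_system_def)
  have memb: "T f (T (s k) x) \<in> X" "T f (T (s k) y) \<in> X" using TX fS sS x yX by auto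
  have 1: "\<rho> y (T f (T (s k) y)) < e / 2" using f(2) by (simp add: W_def Tadd yX)
  have "\<rho> y (T f (T (s k) x)) \<le> \<rho> y (T f (T (s k) y)) + \<rho> (T f (T (s k) x)) (T f (T (s k) y))"
    using triangle[of y "T f (T (s k) y)" "T f (T (s k) x)"] memb yX by (simp add: commute)
  then have "\<rho> y (T f (T (s k) x)) < e" using 1 k[OF f(1)] by simp
  then have "T (f + s k) x \<in> V" "T (f + s k) y \<in> V"
    using e 1 memb yX by (auto simp: Tadd x subset_iff)
  then show ?thesis using S[OF fS sS[of k]] by auto
qed

text \<open>Common return times \<open>s k\<close> are chosen for shrinking neighbourhoods
  \<open>W k\<close> such that \<open>T (s k)\<close> maps \<open>W (Suc k)\<close> into
  \<open>W k\<close>; the return of \<open>y\<close> keeps \<open>y\<close> in every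
  \<open>W k\<close>. A sum is then applied to \<open>x\<close> from its largest index down to its
  smallest.\<close>

lemma central_imp_IP_set:
  fixes S :: "'a::ab_group_add set"
  assumes S: "\<And>s t. s \<in> S \<Longrightarrow> t \<in> S \<Longrightarrow> s + t \<in> S" and A: "central S A"
  shows "IP_set S A"
proof -
  obtain X :: "real set" and \<rho> T where "A \<subseteq> S" and via: "central_via S A X \<rho> T"
    using A unfolding central_def by (elim conjE exE)
  then obtain x y U where DS: "dynamical_system S X \<rho> T" and x: "x \<in> X" and y: "uniformly_recurrent S X \<rho> T y"
    and xy: "proximal S \<rho> T x y" and U: "openin (Metric_space.mtopology X \<rho>) U" "y \<in> U"
    and sub: "{s \<in> S. T s x \<in> U} \<subseteq> A"
    unfolding central_via_def by (elim conjE exE bexE)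
  interpret Metric_space X \<rho> using DS by (simp add: dynamical_system_def)
  have hom: "homeomorphic_map mtopology mtopology (T s)" if "s \<in> S" for s
    using DS that by (simp add: dynamical_system_def)
  have yX: "y \<in> X" using y by (simp add: uniformly_recurrent_def)
  have "\<exists>s. openin mtopology V \<longrightarrow> y \<in> V \<longrightarrow> s \<in> S \<and> T s x \<in> V \<and> T s y \<in> V" for V
    using proximal_common_return[OF DS S x y xy, of V] by (cases "openin mtopology V \<and> y \<in> V") auto
  then obtain g where g: "\<And>V. openin mtopology V \<Longrightarrow> y \<in> V \<Longrightarrow> g V \<in> S \<and> T (g V) x \<in> V \<and> T (g V) y \<in> V"
    by metis
  define W where "W = rec_nat U (\<lambda>_ V. V \<inter> {z \<in> X. T (g V) z \<in> V})"
  have W0: "W 0 = U" and WS: "W (Suc k) = W k \<inter> {z \<in> X. T (g (W k)) z \<in> W k}" for k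
    by (simp_all add: W_def)
  have W: "openin mtopology (W k) \<and> y \<in> W k" for k
  proof (induction k)
    case (Suc k)
    have "g (W k) \<in> S" using g Suc by simp
    then have "openin mtopology {z \<in> X. T (g (W k)) z \<in> W k}"
      using openin_continuous_map_preimage[OF homeomorphic_imp_continuous_map[OF hom]] Suc
      by (metis topspace_mtopology)
    then show ?case using Suc g[of "W k"] yX by (auto simp: WS)
  qed (simp add: W0 U)
  define s where "s k = g (W k)" for k
  have s: "s k \<in> S" "T (s k) x \<in> W k" for k using g W by (auto simp: s_def)
  have anti: "W l \<subseteq> W k" if "k \<le> l" for k l
    using that by (induction rule: dec_induct) (auto simp: WS)
  have key: "sum s \<alpha> \<in> S \<and> T (sum s \<alpha>) x \<in> W k"
    if "finite \<alpha>" "\<alpha> \<noteq> {}" "\<And>i. i \<in> \<alpha> \<Longrightarrow> k \<le> i" for \<alpha> k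
    using that
  proof (induction "card \<alpha>" arbitrary: \<alpha> k)
    case 0
    then show ?case by simp
  next
    case (Suc n)
    define j where "j = Min \<alpha>"
    have j: "j \<in> \<alpha>" "\<And>i. i \<in> \<alpha> \<Longrightarrow> j \<le> i" using Suc.prems by (auto simp: j_def)
    have kj: "W j \<subseteq> W k" using anti Suc.prems(3) j(1) by simp
    have split: "sum s \<alpha> = s j + sum s (\<alpha> - {j})" using Suc.prems(1) j(1) by (simp add: sum.remove[of \<alpha> j])
    show ?case
    proof (cases "\<alpha> - {j} = {}")
      case True
      then have "sum s \<alpha> = s j" unfolding split True by simp
      then show ?thesis using s[of j] kj by auto
    next
      case False
      have "sum s (\<alpha> - {j}) \<in> S \<and> T (sum s (\<alpha> - {j})) x \<in> W (Suc j)"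
      proof (rule Suc.hyps(1))
        show "n = card (\<alpha> - {j})" using Suc.hyps(2) Suc.prems(1) j(1) by simp
        show "Suc j \<le> i" if "i \<in> \<alpha> - {j}" for i using j(2)[of i] that by auto
      qed (use False Suc.prems(1) in auto)
      moreover from this have "T (s j + sum s (\<alpha> - {j})) x = T (s j) (T (sum s (\<alpha> - {j})) x)"
        using DS s x by (simp add: dynamical_system_def)
      ultimately show ?thesis using kj s(1)[of j] S unfolding split by (auto simp: WS s_def)
    qed
  qed
  have "FS UNIV s \<subseteq> A"
  proof
    fix a assume "a \<in> FS UNIV s"
    then obtain \<alpha> where "finite \<alpha>" "\<alpha> \<noteq> {}" "a = sum s \<alpha>" by (auto simp: FS_def)
    then show "a \<in> A" using key[of \<alpha> 0] sub by (auto simp: W0)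
  qed
  then show ?thesis unfolding IP_set_def using \<open>A \<subseteq> S\<close> s(1) by (intro conjI exI[of _ s]) auto
qed

lemma compact_binary_functions: "compact {z :: 'a \<Rightarrow> real. \<forall>t. z t \<in> {0, 1}}"
proof -
  have "compactin (product_topology (\<lambda>_::'a. euclideanreal) UNIV) (PiE UNIV (\<lambda>_. {0, 1}))"
    unfolding compactin_PiE by (intro disjI2 ballI) simp
  moreover have "PiE UNIV (\<lambda>_. {0, 1}) = {z :: 'a \<Rightarrow> real. \<forall>t. z t \<in> {0, 1}}"
    by (auto simp: PiE_def Pi_def)
  ultimately show ?thesis by (simp add: euclidean_product_topology)
qed

text \<open>
  The witnessing system is the full shift on binary functions: the indicator of \<open>Q\<close> is uniformly
  recurrent, and the indicator of \<open>A\<close> is proximal to it.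
\<close>

lemma central_if_copies:
  fixes S :: "'a::{ab_group_add, countable} set"
  assumes AS: "A \<subseteq> S" and Q: "0 \<in> Q"
    and rec: "\<And>F. finite F \<Longrightarrow> syndetic S {s \<in> S. \<forall>t\<in>F. s + t \<in> Q \<longleftrightarrow> t \<in> Q}"
    and copy: "\<And>F. finite F \<Longrightarrow> \<exists>s\<in>S. \<forall>t\<in>F. s + t \<in> A \<longleftrightarrow> s + t \<in> Q"
  shows "central S A"
proof -
  \<comment> \<open>Functions on the whole group, not only on \<open>S\<close>, so that each shift
    has an inverse.\<close>
  define X :: "('a \<Rightarrow> real) set" where "X = {z. \<forall>t. z t \<in> {0, 1}}"
  define T :: "'a \<Rightarrow> ('a \<Rightarrow> real) \<Rightarrow> 'a \<Rightarrow> real" where "T s z = (\<lambda>t. z (s + t))" for s z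
  interpret Metric_space X dist using Met_TC.subspace by blast
  interpret sub: Submetric UNIV dist X by unfold_locales auto
  have top: "mtopology = subtopology euclidean X" using sub.mtopology_submetric by simp
  have cX: "compact_space mtopology"
    unfolding top unfolding X_def
    by (rule compact_space_subtopology) (simp add: compact_binary_functions del: insert_iff)
  have TX: "T s z \<in> X" if "z \<in> X" for s z using that by (simp add: X_def T_def)
  have cont: "continuous_map mtopology mtopology (T s)" for s
  proof -
    have "continuous_on UNIV (T s)"
      unfolding T_def by (intro continuous_on_coordinatewise_then_product) simp
    then show ?thesis unfolding top
      using TX by (auto simp: continuous_map_in_subtopology intro: continuous_on_subset)
  qed
  have TT: "T (s + t) z = T s (T t z)" for s t z by (simp add: T_def add_ac)
  have ds: "dynamical_system S X dist T"
    unfolding dynamical_system_def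
  proof (intro conjI ballI)
    show "homeomorphic_map mtopology mtopology (T s)" for s
      unfolding homeomorphic_map_maps homeomorphic_maps_def
      by (intro exI[of _ "T (- s)"] conjI cont) (simp_all add: T_def)
  qed (use cX TT Metric_space_axioms in auto)
  \<comment> \<open>Finitely many coordinates control the metric, which turns \<open>rec\<close>
    into uniform recurrence and \<open>copy\<close> into proximality.\<close>
  have near: "\<exists>F. finite F \<and> (\<forall>u v :: 'a \<Rightarrow> real. (\<forall>t\<in>F. u t = v t) \<longrightarrow> dist u v \<le> (1 / 2) ^ N)" for N :: nat
  proof (intro exI conjI allI impI)
    show "finite (from_nat ` {..N} :: 'a set)" by simp
    fix u v :: "'a \<Rightarrow> real" assume *: "\<forall>t\<in>from_nat ` {..N}. u t = v t"
    have "{dist (u (from_nat n)) (v (from_nat n)) |n. n \<le> N} = {0}"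
      using * by (auto intro: exI[of _ 0])
    then show "dist u v \<le> (1 / 2) ^ N" using dist_fun_le_dist_first_terms[of u v N] by simp
  qed
  then obtain F where F: "\<And>N. finite (F N)"
    "\<And>N (u :: 'a \<Rightarrow> real) v. (\<forall>t\<in>F N. u t = v t) \<Longrightarrow> dist u v \<le> (1 / 2) ^ N"
    by metis
  define x :: "'a \<Rightarrow> real" where "x = indicator A"
  define y :: "'a \<Rightarrow> real" where "y = indicator Q"
  have xX: "x \<in> X" and yX: "y \<in> X" by (auto simp: x_def y_def X_def indicator_def)
  have ur: "uniformly_recurrent S X dist T y"
    unfolding uniformly_recurrent_def
  proof (intro conjI allI impI)
    fix U assume U: "openin mtopology U" "y \<in> U"
    then obtain e where e: "e > 0" "mball y e \<subseteq> U" by (auto simp: openin_mtopology)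
    obtain N where N: "(1 / 2 :: real) ^ N < e" using real_arch_pow_inv[of e "1 / 2"] e by auto
    show "syndetic S {s \<in> S. T s y \<in> U}"
    proof (rule syndetic_mono[OF rec[OF F(1)[of N]]])
      show "{s \<in> S. \<forall>t\<in>F N. s + t \<in> Q \<longleftrightarrow> t \<in> Q} \<subseteq> {s \<in> S. T s y \<in> U}"
      proof (intro subsetI CollectI conjI)
        fix s assume s: "s \<in> {s \<in> S. \<forall>t\<in>F N. s + t \<in> Q \<longleftrightarrow> t \<in> Q}"
        then show "s \<in> S" by simp
        have "dist y (T s y) \<le> (1 / 2) ^ N" by (rule F(2)) (use s in \<open>simp add: T_def y_def indicator_def\<close>)
        then have "T s y \<in> mball y e" using N TX[OF yX] yX by simp
        then show "T s y \<in> U" using e(2) by auto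
      qed
    qed auto
  qed (rule yX)
  have pr: "proximal S dist T x y"
  proof -
    obtain s where s: "\<And>N. s N \<in> S" "\<And>N t. t \<in> F N \<Longrightarrow> s N + t \<in> A \<longleftrightarrow> s N + t \<in> Q"
      using copy[OF F(1)] by metis
    have "dist (T (s N) x) (T (s N) y) \<le> (1 / 2) ^ N" for N
      by (rule F(2)) (simp add: T_def x_def y_def indicator_def s(2))
    then have "(\<lambda>N. dist (T (s N) x) (T (s N) y)) \<longlonglongrightarrow> 0"
      by (intro tendsto_sandwich[OF _ _ tendsto_const LIMSEQ_power_zero[of "1 / 2 :: real"]]) auto
    then show ?thesis unfolding proximal_def using s(1) by auto
  qed
  \<comment> \<open>\<open>U\<close> reads off the value at \<open>0\<close>, where
    \<open>T s x\<close> has the value of the indicator of \<open>A\<close> at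
    \<open>s\<close>.\<close>
  define U where "U = X \<inter> {z. z 0 > 1 / 2}"
  have "open {z :: 'a \<Rightarrow> real. z 0 > 1 / 2}"
    by (intro open_Collect_less continuous_intros) simp
  then have op: "openin mtopology U" unfolding top U_def by (simp add: openin_open_Int)
  have "y \<in> U" using Q yX by (simp add: U_def y_def)
  moreover have "{s \<in> S. T s x \<in> U} \<subseteq> A" by (auto simp: U_def T_def x_def indicator_def split: if_splits)
  ultimately have "central_via S A X dist T"
    unfolding central_via_def using ds ur pr op xX by blast
  then show ?thesis by (rule central_viaI[OF AS])
qed

section \<open>Integer-valued polynomials\<close>

lemma dvd_shift_multiple:
  fixes f :: "int \<Rightarrow> int"
  assumes "\<And>n. k dvd f (n + a) - f n"
  shows "k dvd f (n + a * t) - f n"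
proof (induction t rule: int_induct[of _ 0])
  case (step1 t)
  have "f (n + a * (t + 1)) - f n = (f ((n + a * t) + a) - f (n + a * t)) + (f (n + a * t) - f n)"
    by (simp add: algebra_simps)
  then show ?case using dvd_add[OF assms step1(2)] by metis
next
  case (step2 t)
  have "f (n + a * (t - 1)) - f n = (f (n + a * t) - f n) - (f ((n + a * (t - 1)) + a) - f (n + a * (t - 1)))"
    by (simp add: algebra_simps)
  then show ?case using dvd_diff[OF step2(2) assms] by metis
qed simp

text \<open>
  By induction on the degree: if the difference function has period \<open>r\<close> modulo \<open>k\<close>, then \<open>P\<close> grows
  by a constant modulo \<open>k\<close> over each step of length \<open>r\<close>, so \<open>k * r\<close> is a period.
\<close>

lemma integer_valued_poly_periodic:
  fixes p :: "real poly" and P :: "int \<Rightarrow> int"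
  assumes "\<And>n. of_int (P n) = poly p (of_int n)" and k: "k > 0"
  shows "\<exists>r>0. \<forall>a b. r dvd a - b \<longrightarrow> k dvd P a - P b"
  using assms(1)
proof (induction "degree p" arbitrary: p P rule: less_induct)
  case less
  show ?case
  proof (cases "degree p = 0")
    case True
    then obtain c where "p = [:c:]" by (auto elim: degree_eq_zeroE)
    then have "real_of_int (P a) = of_int (P b)" for a b using less.prems by simp
    then have "P a - P b = 0" for a b by simp
    then show ?thesis by (intro exI[of _ 1]) (simp only:, simp)
  next
    case False
    define q where "q = pcompose p [:1, 1:] - p"
    have dc: "degree (pcompose p [:1, 1:]) = degree p" by (simp add: degree_pcompose)
    have "lead_coeff (pcompose p [:1, 1:]) = lead_coeff p" by (subst lead_coeff_comp) auto
    then have "coeff q (degree p) = 0" by (simp add: q_def dc)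
    moreover have "degree q \<le> degree p" unfolding q_def by (intro degree_diff_le) (simp_all add: dc)
    ultimately have "degree q < degree p"
      using False by (metis degree_0 leading_coeff_0_iff le_neq_implies_less neq0_conv)
    moreover have "of_int (P (n + 1) - P n) = poly q (of_int n)" for n
      using less.prems[of n] less.prems[of "n + 1"] by (simp add: q_def poly_pcompose add.commute)
    ultimately obtain r where r: "r > 0"
      "\<And>a b. r dvd a - b \<Longrightarrow> k dvd (P (a + 1) - P a) - (P (b + 1) - P b)"
      using less.hyps[of q "\<lambda>n. P (n + 1) - P n"] by auto
    define G where "G n = P (n + r) - P n" for n
    have "k dvd G (n + 1) - G n" for n
    proof -
      have "G (n + 1) - G n = (P (n + r + 1) - P (n + r)) - (P (n + 1) - P n)"
        by (simp add: G_def algebra_simps)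
      then show ?thesis using r(2)[of "n + r" n] by simp
    qed
    then have G: "k dvd G n - G 0" for n using dvd_shift_multiple[of k G 1 0 n] by simp
    have step: "k dvd P (n + r * int j) - P n - int j * G 0" for n j
    proof (induction j)
      case (Suc j)
      have "P (n + r * int (Suc j)) - P n - int (Suc j) * G 0 =
          (G (n + r * int j) - G 0) + (P (n + r * int j) - P n - int j * G 0)"
        by (simp add: G_def algebra_simps)
      then show ?case using dvd_add[OF G Suc] by metis
    qed simp
    have "k dvd P (n + r * k) - P n" for n
    proof -
      have "k dvd (P (n + r * k) - P n - k * G 0) + k * G 0"
        using step[of n "nat k"] k by (intro dvd_add) auto
      then show ?thesis by simp
    qed
    then have *: "k dvd P (n + r * k * t) - P n" for n t
      using dvd_shift_multiple[of k P "r * k"] by simp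
    have "k dvd P a - P b" if "r * k dvd a - b" for a b
    proof -
      obtain t where "a - b = r * k * t" using \<open>r * k dvd a - b\<close> by (rule dvdE)
      then have "a = b + r * k * t" by simp
      then show ?thesis using * by simp
    qed
    then show ?thesis using r(1) k by (intro exI[of _ "r * k"]) simp
  qed
qed

text \<open>The derivative is nonconstant with positive leading coefficient, hence eventually at
  least \<open>L\<close>; the mean value theorem transfers this to increments.\<close>

lemma poly_increment_ge:
  fixes p :: "real poly"
  assumes "degree p \<ge> 2" "lead_coeff p > 0" "L \<ge> 0"
  shows "\<exists>x0. \<forall>x\<ge>x0. \<forall>y\<ge>x + 1. poly p y - poly p x \<ge> L"
proof -
  define q where "q = [:- L:] + pderiv p"
  have deg: "degree (pderiv p) = degree p - 1" by (rule degree_pderiv)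
  have "lead_coeff q = lead_coeff (pderiv p)"
    unfolding q_def by (rule lead_coeff_add_le) (use assms(1) deg in simp)
  also have "\<dots> = of_nat (degree p) * lead_coeff p"
    using assms(1) by (simp add: deg coeff_pderiv)
  finally have "lead_coeff q > 0" using assms by simp
  then obtain x0 where x0: "\<And>x. x \<ge> x0 \<Longrightarrow> poly q x > 0"
    using poly_pinfty_gt_lc by (metis less_le_trans)
  have "poly p y - poly p x \<ge> L" if "x \<ge> x0" "y \<ge> x + 1" for x y
  proof -
    have "x < y" using that by linarith
    from poly_MVT[OF this, of p]
    obtain z where z: "x < z" "poly p y - poly p x = (y - x) * poly (pderiv p) z" by auto
    have "L \<le> poly (pderiv p) z" using x0[of z] z(1) that by (simp add: q_def)
    then have "1 * L \<le> (y - x) * poly (pderiv p) z" using that assms(3) by (intro mult_mono) auto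
    then show ?thesis using z(2) by simp
  qed
  then show ?thesis by blast
qed

text \<open>Degree at least 2 enters here: for a linear polynomial consecutive values have constant
  distance. A change of sign makes the leading coefficient positive.\<close>

lemma poly_gaps:
  fixes p :: "real poly" and P :: "int \<Rightarrow> int"
  assumes P: "\<And>n. of_int (P n) = poly p (of_int n)" and deg: "degree p \<ge> 2"
  shows "\<exists>N. \<forall>m\<ge>N. \<forall>n\<ge>N. m \<noteq> n \<longrightarrow> L < \<bar>P m - P n\<bar>"
proof -
  define q where "q = (if lead_coeff p > 0 then p else - p)"
  have "lead_coeff p \<noteq> 0" using deg by auto
  then have "lead_coeff p > 0 \<or> lead_coeff p < 0" by linarith
  then have q: "degree q \<ge> 2" "lead_coeff q > 0" using deg by (auto simp: q_def)
  have qP: "\<bar>poly q (of_int m) - poly q (of_int n)\<bar> = of_int \<bar>P m - P n\<bar>" for m n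
    by (auto simp: q_def P)
  obtain x0 where x0: "\<And>x y. x \<ge> x0 \<Longrightarrow> y \<ge> x + 1 \<Longrightarrow> poly q y - poly q x \<ge> of_int (\<bar>L\<bar> + 1)"
    using poly_increment_ge[OF q, of "of_int (\<bar>L\<bar> + 1)"] by auto
  have lt: "L < \<bar>P m - P n\<bar>" if "m \<ge> \<lceil>x0\<rceil>" "m < n" for m n
  proof -
    have "real_of_int m + 1 \<le> of_int n" using that(2) by linarith
    moreover have "x0 \<le> of_int m" using that(1) by linarith
    ultimately have "real_of_int (\<bar>L\<bar> + 1) \<le> of_int \<bar>P n - P m\<bar>" using x0 qP[of n m] by fastforce
    then show ?thesis by linarith
  qed
  have "L < \<bar>P m - P n\<bar>" if "m \<ge> \<lceil>x0\<rceil>" "n \<ge> \<lceil>x0\<rceil>" "m \<noteq> n" for m n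
    using lt[of m n] lt[of n m] that by (metis abs_minus_commute linorder_neqE)
  then show ?thesis by blast
qed

section \<open>Sparse boxes\<close>

text \<open>The growth property through which the degree hypothesis acts, assumed for every bound
  \<open>L\<close>.\<close>

locale wide_gaps =
  fixes P :: "int \<Rightarrow> int"
  assumes gaps: "\<exists>N. \<forall>m\<ge>N. \<forall>n\<ge>N. m \<noteq> n \<longrightarrow> L < \<bar>P m - P n\<bar>"
begin

text \<open>The factor 2 pays for two errors of size at most \<open>L\<close>: the difference of
  first coordinates inside a box of side \<open>L\<close>, and a value from an earlier box. Starting
  beyond \<open>L\<close> makes the second coordinates of the corners superincreasing.\<close>

definition gap_start :: "int \<Rightarrow> int" where
  "gap_start L = (SOME N. L < N \<and> (\<forall>m\<ge>N. \<forall>n\<ge>N. m \<noteq> n \<longrightarrow> 2 * L < \<bar>P m - P n\<bar>))"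

lemma gap_start: "L < gap_start L"
  "gap_start L \<le> m \<Longrightarrow> gap_start L \<le> n \<Longrightarrow> m \<noteq> n \<Longrightarrow> 2 * L < \<bar>P m - P n\<bar>"
proof -
  obtain N where "\<forall>m\<ge>N. \<forall>n\<ge>N. m \<noteq> n \<longrightarrow> 2 * L < \<bar>P m - P n\<bar>" using gaps[of "2 * L"] ..
  then have "\<exists>N. L < N \<and> (\<forall>m\<ge>N. \<forall>n\<ge>N. m \<noteq> n \<longrightarrow> 2 * L < \<bar>P m - P n\<bar>)"
    by (intro exI[of _ "max N (L + 1)"]) simp
  from someI_ex[OF this] show "L < gap_start L"
    "gap_start L \<le> m \<Longrightarrow> gap_start L \<le> n \<Longrightarrow> m \<noteq> n \<Longrightarrow> 2 * L < \<bar>P m - P n\<bar>"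
    unfolding gap_start_def[symmetric] by auto
qed

definition amplitude :: "int \<Rightarrow> int" where
  "amplitude L = (\<Sum>n\<in>{gap_start L..gap_start L + L}. \<bar>P n\<bar>)"

text \<open>Values in a box of side \<open>L\<close> lie above
  \<open>2 * L + 2 * amplitude L\<close> and are at most \<open>3 * L + 4 * amplitude L + 1\<close>,
  so no two of them add up to a third.\<close>

definition base :: "int \<Rightarrow> int" where
  "base L = 2 * L + 3 * amplitude L + 1"

text \<open>The side of the \<open>k\<close>-th box, large enough to dominate the values in all
  earlier boxes and the sums of their corners.\<close>

primrec len :: "nat \<Rightarrow> int" where
  "len 0 = 0"
| "len (Suc k) = len k + base (len k) + gap_start (len k) + amplitude (len k) + 1"

definition corner :: "nat \<Rightarrow> int \<times> int" where
  "corner k = (base (len k), gap_start (len k))"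

definition box :: "nat \<Rightarrow> (int \<times> int) set" where
  "box k = {fst (corner k)..fst (corner k) + len k} \<times> {snd (corner k)..snd (corner k) + len k}"

definition val :: "int \<times> int \<Rightarrow> int" where
  "val s = fst s + P (snd s)"

lemma amplitude_nonneg: "0 \<le> amplitude L"
  by (simp add: amplitude_def sum_nonneg)

lemma amplitude: "gap_start L \<le> n \<Longrightarrow> n \<le> gap_start L + L \<Longrightarrow> \<bar>P n\<bar> \<le> amplitude L"
  unfolding amplitude_def by (rule member_le_sum) auto

lemma int_le_len: "int k \<le> len k"
proof (induction k)
  case (Suc k)
  then show ?case using gap_start(1)[of "len k"] amplitude_nonneg[of "len k"]
    by (simp add: base_def)
qed simp

lemma len_nonneg: "0 \<le> len k"
  using int_le_len[of k] by linarith

lemma corner_pos: "0 < fst (corner k)" "len k < snd (corner k)" "0 < snd (corner k)"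
  using gap_start(1)[of "len k"] amplitude_nonneg[of "len k"] len_nonneg[of k]
  by (auto simp: corner_def base_def)

lemma len_Suc: "len k + fst (corner k) \<le> len (Suc k)" "len k + snd (corner k) \<le> len (Suc k)"
  "len k + fst (corner k) + amplitude (len k) \<le> len (Suc k)"
  using corner_pos[of k] amplitude_nonneg[of "len k"] len_nonneg[of k] by (auto simp: corner_def)

lemma len_mono: "i \<le> k \<Longrightarrow> len i \<le> len k"
proof (induction rule: dec_induct)
  case (step k)
  then show ?case using len_Suc(1)[of k] corner_pos(1)[of k] by linarith
qed simp

lemma box_val:
  assumes "s \<in> box k"
  shows "2 * len k + 2 * amplitude (len k) < val s" "val s \<le> fst (corner k) + len k + amplitude (len k)"
proof -
  have "\<bar>P (snd s)\<bar> \<le> amplitude (len k)"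
    by (rule amplitude) (use assms in \<open>auto simp: box_def corner_def\<close>)
  moreover have "base (len k) \<le> fst s" "fst s \<le> base (len k) + len k"
    using assms by (auto simp: box_def corner_def)
  ultimately show "2 * len k + 2 * amplitude (len k) < val s"
    "val s \<le> fst (corner k) + len k + amplitude (len k)"
    by (simp_all add: val_def base_def corner_def)
qed

lemma box_val_gt: "s \<in> box k \<Longrightarrow> 2 * len k < val s"
  using box_val(1) amplitude_nonneg[of "len k"] by fastforce

lemma box_val_pos: "s \<in> box k \<Longrightarrow> 0 < val s"
  using box_val_gt len_nonneg[of k] by fastforce

lemma box_val_le: "s \<in> box i \<Longrightarrow> i < k \<Longrightarrow> val s \<le> len k"
  using box_val(2)[of s i] len_Suc(3)[of i] len_mono[of "Suc i" k] by fastforce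

text \<open>
  Sparseness forces \<open>s\<close> and \<open>u\<close> into one box whose side exceeds \<open>val t\<close>; there the gaps between
  values of \<open>P\<close> are too wide for the second coordinates to differ.
\<close>

lemma val_sum_imp_snd_eq:
  assumes s: "s \<in> box i" and t: "t \<in> box j" and u: "u \<in> box k"
    and sum: "val s + val t = val u" and ts: "val t \<le> val s"
  shows "snd u = snd s"
proof -
  note pos = box_val_pos[OF s] box_val_pos[OF t]
  have "j \<le> i"
    using box_val_le[OF s, of j] box_val_gt[OF t] ts len_nonneg[of j] by (cases "i < j") auto
  have "i \<le> k"
    using box_val_le[OF u, of i] box_val_gt[OF s] sum pos len_nonneg[of i] by (cases "k < i") auto
  \<comment> \<open>A value from a later box would exceed twice every earlier value.\<close>
  have "k = i"
  proof (rule ccontr)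
    assume "k \<noteq> i"
    then have "i < k" "j < k" using \<open>i \<le> k\<close> \<open>j \<le> i\<close> by auto
    then show False using box_val_le[OF s, of k] box_val_le[OF t, of k] box_val_gt[OF u] sum by linarith
  qed
  \<comment> \<open>Two values from the same box already add up to more than any value of that
    box.\<close>
  have "j < i"
  proof (rule ccontr)
    assume "\<not> j < i"
    then have "j = i" using \<open>j \<le> i\<close> by simp
    have "fst (corner i) = 2 * len i + 3 * amplitude (len i) + 1" by (simp add: corner_def base_def)
    moreover have "2 * len i + 2 * amplitude (len i) < val s" "2 * len i + 2 * amplitude (len i) < val t"
      using box_val(1)[OF s] box_val(1)[OF t] \<open>j = i\<close> by auto
    moreover have "val u \<le> fst (corner i) + len i + amplitude (len i)"
      using box_val(2)[OF u] \<open>k = i\<close> by simp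
    ultimately show False using sum len_nonneg[of i] amplitude_nonneg[of "len i"] by linarith
  qed
  have t': "val t \<le> len i" using box_val_le[OF t \<open>j < i\<close>] .
  show ?thesis
  proof (rule ccontr)
    assume "snd u \<noteq> snd s"
    then have "2 * len i < \<bar>P (snd u) - P (snd s)\<bar>"
      by (intro gap_start(2)) (use s u \<open>k = i\<close> in \<open>auto simp: box_def corner_def\<close>)
    moreover have "\<bar>fst u - fst s\<bar> \<le> len i"
      using s u \<open>k = i\<close> by (auto simp: box_def)
    \<comment> \<open>Both terms on the right have modulus at most \<open>len i\<close>, against a
      gap of more than \<open>2 * len i\<close>.\<close>
    moreover have "P (snd u) - P (snd s) = val t - (fst u - fst s)" using sum by (simp add: val_def)
    ultimately show False using t' pos by linarith
  qed
qed

section \<open>Finite sums of the corners\<close>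

lemma box_subset: "box k \<subseteq> Npos \<times> Npos"
  using corner_pos[of k] by (auto simp: box_def Npos_def)

lemma sum_corner_less:
  "sum (fst \<circ> corner) {..<k} \<le> len k" "sum (snd \<circ> corner) {..<k} \<le> len k"
proof (induction k)
  case (Suc k)
  case 1
  then show ?case using Suc len_Suc[of k] by simp
next
  case (Suc k)
  case 2
  then show ?case using Suc len_Suc[of k] by simp
qed simp_all

lemma sum_corner_le:
  assumes "\<alpha> \<subseteq> {..<k}"
  shows "0 \<le> fst (sum corner \<alpha>)" "fst (sum corner \<alpha>) \<le> len k"
    "0 \<le> snd (sum corner \<alpha>)" "snd (sum corner \<alpha>) \<le> len k"
proof -
  have nn: "0 \<le> fst (corner i)" "0 \<le> snd (corner i)" for i
    using corner_pos[of i] by simp_all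
  have "(\<Sum>i\<in>\<alpha>. fst (corner i)) \<le> (\<Sum>i<k. fst (corner i))" "(\<Sum>i\<in>\<alpha>. snd (corner i)) \<le> (\<Sum>i<k. snd (corner i))"
    by (intro sum_mono2; use assms nn in simp)+
  then show "0 \<le> fst (sum corner \<alpha>)" "fst (sum corner \<alpha>) \<le> len k"
    "0 \<le> snd (sum corner \<alpha>)" "snd (sum corner \<alpha>) \<le> len k"
    using sum_corner_less[of k] nn by (auto simp: fst_sum snd_sum o_def intro: sum_nonneg)
qed

text \<open>The largest index picks the box; the earlier corners add an offset between 0 and its
  side.\<close>

lemma FS_corner_subset: "FS UNIV corner \<subseteq> (\<Union>k. box k)"
proof
  fix s assume "s \<in> FS UNIV corner"
  then obtain \<alpha> where \<alpha>: "finite \<alpha>" "\<alpha> \<noteq> {}" "s = sum corner \<alpha>" by (auto simp: FS_def)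
  define k where "k = Max \<alpha>"
  have k: "k \<in> \<alpha>" "\<alpha> - {k} \<subseteq> {..<k}"
    using \<alpha> Max_ge[OF \<alpha>(1)] by (auto simp: k_def less_le)
  have "s = corner k + sum corner (\<alpha> - {k})" using \<alpha> k(1) by (simp add: sum.remove[of \<alpha> k])
  then have "s \<in> box k" using sum_corner_le[OF k(2)] by (auto simp: box_def mem_Times_iff)
  then show "s \<in> (\<Union>k. box k)" by blast
qed

text \<open>\<open>snd (corner k)\<close> exceeds the sum of all earlier second coordinates, so the
  index set can be read off from the top, as with binary digits.\<close>

lemma snd_sum_corner_inj:
  assumes "snd (sum corner \<alpha>) = snd (sum corner \<beta>)" "\<alpha> \<subseteq> {..<k}" "\<beta> \<subseteq> {..<k}"
  shows "\<alpha> = \<beta>"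
  using assms
proof (induction k arbitrary: \<alpha> \<beta>)
  case (Suc k)
  have fin: "finite \<alpha>" "finite \<beta>" using Suc.prems finite_subset by blast+
  have sub: "\<alpha> - {k} \<subseteq> {..<k}" "\<beta> - {k} \<subseteq> {..<k}" using Suc.prems by (auto simp: less_Suc_eq)
  have split: "snd (sum corner \<gamma>) = (if k \<in> \<gamma> then snd (corner k) else 0) + snd (sum corner (\<gamma> - {k}))"
    if "finite \<gamma>" for \<gamma>
  proof (cases "k \<in> \<gamma>")
    case True
    then show ?thesis unfolding sum.remove[OF that True] by simp
  qed simp
  have "k \<in> \<alpha> \<longleftrightarrow> k \<in> \<beta>" "snd (sum corner (\<alpha> - {k})) = snd (sum corner (\<beta> - {k}))"
  proof -
    have *: "(if k \<in> \<alpha> then snd (corner k) else 0) + snd (sum corner (\<alpha> - {k})) =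
        (if k \<in> \<beta> then snd (corner k) else 0) + snd (sum corner (\<beta> - {k}))"
      using Suc.prems(1) unfolding split[OF fin(1)] split[OF fin(2)] .
    note bounds = corner_pos(2)[of k] sum_corner_le(3,4)[OF sub(1)] sum_corner_le(3,4)[OF sub(2)]
    show "k \<in> \<alpha> \<longleftrightarrow> k \<in> \<beta>"
      using * bounds by (cases "k \<in> \<alpha>"; cases "k \<in> \<beta>"; simp)
    then show "snd (sum corner (\<alpha> - {k})) = snd (sum corner (\<beta> - {k}))" using * by simp
  qed
  moreover have "\<alpha> - {k} = \<beta> - {k}" by (rule Suc.IH) (use sub calculation(2) in auto)
  ultimately show ?case by blast
qed simp

text \<open>If \<open>val s + val t = val u\<close>, the larger summand \<open>s\<close> shares its
  second coordinate with \<open>u\<close>, hence its index set. Then \<open>s = u\<close>, and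
  \<open>val t\<close> would be 0.\<close>

lemma val_FS_sum_free:
  assumes "x \<in> val ` FS UNIV corner" "y \<in> val ` FS UNIV corner" "x + y \<in> val ` FS UNIV corner"
  shows False
proof -
  have main: False
    if s: "s \<in> FS UNIV corner" and t: "t \<in> FS UNIV corner" and u: "u \<in> FS UNIV corner"
      and sum: "val s + val t = val u" and ts: "val t \<le> val s" for s t u
  proof -
    obtain i j k where ijk: "s \<in> box i" "t \<in> box j" "u \<in> box k"
      using FS_corner_subset s t u by blast
    obtain \<alpha> \<beta> where \<alpha>\<beta>: "finite \<alpha>" "s = sum corner \<alpha>" "finite \<beta>" "u = sum corner \<beta>"
      using s u unfolding FS_def by blast
    obtain l where "\<alpha> \<union> \<beta> \<subseteq> {..<l}" using \<alpha>\<beta> finite_nat_bounded[of "\<alpha> \<union> \<beta>"] by auto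
    then have "\<beta> = \<alpha>"
      using val_sum_imp_snd_eq[OF ijk sum ts] \<alpha>\<beta> by (intro snd_sum_corner_inj[of _ _ l]) auto
    then show False using \<alpha>\<beta> sum box_val_pos[OF ijk(2)] by simp
  qed
  obtain s t u where "s \<in> FS UNIV corner" "t \<in> FS UNIV corner" "u \<in> FS UNIV corner"
    "x = val s" "y = val t" "x + y = val u"
    using assms by (elim imageE)
  moreover have "val t \<le> val s \<or> val s \<le> val t" by linarith
  ultimately show False using main[of s t u] main[of t s u] by (auto simp: add.commute)
qed

text \<open>Partial sums serve as the sequence: their differences are sums over blocks of indices,
  and the positivity of these makes the sequence injective.\<close>

lemma corner_Delta_set:
  assumes T: "\<And>s t. s \<in> T \<Longrightarrow> t \<in> T \<Longrightarrow> s + t \<in> T" "Npos \<times> Npos \<subseteq> T"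
  shows "Delta_set T (FS UNIV corner)"
proof -
  have box: "box k \<subseteq> T" for k using box_subset T(2) by blast
  have FT: "FS UNIV corner \<subseteq> T" using FS_corner_subset box by blast
  define x where "x j = sum corner {..j}" for j
  have diff: "x j - x i = sum corner {i<..j}" if "i < j" for i j
  proof -
    have "{..j} = {..i} \<union> {i<..j}" using that by auto
    moreover have "sum corner ({..i} \<union> {i<..j}) = sum corner {..i} + sum corner {i<..j}"
      by (rule sum.union_disjoint) auto
    ultimately show ?thesis by (simp add: x_def)
  qed
  have FS: "sum corner \<alpha> \<in> FS UNIV corner" if "finite \<alpha>" "\<alpha> \<noteq> {}" for \<alpha>
    using that by (auto simp: FS_def)
  have dF: "x j - x i \<in> FS UNIV corner" if "i < j" for i j
    unfolding diff[OF that] by (rule FS) (use that in auto)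
  have ne: "x j \<noteq> x i" if "i < j" for i j
  proof
    assume "x j = x i"
    then have "0 \<in> FS UNIV corner" using dF[OF that] by simp
    then have "(0 :: int \<times> int) \<in> Npos \<times> Npos" using FS_corner_subset box_subset by blast
    then show False by (simp add: Npos_def zero_prod_def)
  qed
  have "inj x"
  proof (rule injI, rule ccontr)
    fix i j assume "x i = x j" "i \<noteq> j"
    then show False using ne[of i j] ne[of j i] by (cases "i < j") auto
  qed
  moreover have "x j \<in> T" for j unfolding x_def by (rule subsetD[OF FT FS]) auto
  ultimately show ?thesis unfolding Delta_set_def using dF FT by (intro conjI exI[of _ x]) auto
qed

end

section \<open>A central set\<close>

lemma not_power_dvd:
  fixes J :: "int set"
  assumes "finite J" "0 \<notin> J"
  shows "\<exists>k. \<forall>j\<in>J. \<not> 2 ^ k dvd j"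
proof -
  define k where "k = nat (\<Sum>j\<in>J. \<bar>j\<bar>)"
  have "\<not> 2 ^ k dvd j" if "j \<in> J" for j
  proof
    assume "2 ^ k dvd j"
    then have "2 ^ k \<le> \<bar>j\<bar>" using that assms(2) by (metis dvd_imp_le_int abs_numeral abs_power_minus power_abs)
    moreover have "\<bar>j\<bar> \<le> (\<Sum>j\<in>J. \<bar>j\<bar>)" using that assms(1) by (intro member_le_sum) auto
    moreover have "int k < 2 ^ k" using of_nat_less_two_power[of k] by simp
    ultimately show False by (simp add: k_def sum_nonneg)
  qed
  then show ?thesis by blast
qed

lemma syndetic_lattice:
  fixes T :: "(int \<times> int) set"
  assumes T: "T = Npos \<times> Npos \<or> T = UNIV" and r: "r > 0"
  shows "syndetic T {s \<in> T. r dvd fst s \<and> r dvd snd s - b}"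
  unfolding syndetic_def
proof (intro conjI exI)
  \<comment> \<open>Residue representatives start at 1 so that these translations also lie in
    \<open>Npos \<times> Npos\<close>.\<close>
  define F where "F = {1..r} \<times> {1..r}"
  show "finite F" by (simp add: F_def)
  show FT: "F \<subseteq> T" using T by (auto simp: F_def Npos_def)
  have res: "\<exists>i\<in>{1..r}. r dvd i + a" for a
  proof -
    define i where "i = r - a mod r"
    have "0 \<le> a mod r" "a mod r < r" using r by simp_all
    then have "i \<in> {1..r}" unfolding i_def atLeastAtMost_iff by linarith
    moreover have "i + a = r * (1 + a div r)"
      unfolding i_def distrib_left using mult_div_mod_eq[of r a] by linarith
    then have "r dvd i + a" by simp
    ultimately show ?thesis by blast
  qed
  have "\<exists>s\<in>F. s + t \<in> {s \<in> T. r dvd fst s \<and> r dvd snd s - b}" if t: "t \<in> T" for t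
  proof -
    obtain i j where ij: "i \<in> {1..r}" "r dvd i + fst t" "j \<in> {1..r}" "r dvd j + (snd t - b)"
      using res by metis
    then have "(i, j) \<in> F" by (simp add: F_def)
    moreover have "(i, j) + t \<in> T" using T t ij by (auto simp: Npos_def)
    moreover have "r dvd fst ((i, j) + t)" "r dvd snd ((i, j) + t) - b"
      using ij by (simp_all add: algebra_simps)
    ultimately show ?thesis by blast
  qed
  then show "T = (\<Union>s\<in>F. {y \<in> T. s + y \<in> {s \<in> T. r dvd fst s \<and> r dvd snd s - b}})"
    by (intro equalityI subsetI) blast+
qed auto

locale periodic_wide_gaps = wide_gaps +
  assumes periodic: "k > 0 \<Longrightarrow> \<exists>r>0. \<forall>a b. r dvd a - b \<longrightarrow> k dvd P a - P b"
begin

text \<open>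
  The 2-adic valuation of \<open>m\<close> exceeds that of \<open>P n\<close>; the points with \<open>m = 0\<close> belong to the set even if
  \<open>P n = 0\<close>, which puts the origin into it without spoiling uniform recurrence.
\<close>

definition more_even :: "(int \<times> int) set" where
  "more_even = {(m, n). m = 0 \<or> (\<exists>v. \<not> 2 ^ v dvd P n \<and> 2 ^ v dvd m)}"

lemma eventually_nonzero: "\<exists>N. \<forall>n\<ge>N. P n \<noteq> 0"
proof -
  obtain N where N: "\<forall>m\<ge>N. \<forall>n\<ge>N. m \<noteq> n \<longrightarrow> 0 < \<bar>P m - P n\<bar>" using gaps[of 0] ..
  show ?thesis
  proof (cases "\<exists>m\<ge>N. P m = 0")
    case True
    then obtain m where m: "m \<ge> N" "P m = 0" by blast
    have "P n \<noteq> 0" if "n \<ge> m + 1" for n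
    proof -
      have "0 < \<bar>P n - P m\<bar>" using N[rule_format, of n m] that m(1) by simp
      then show ?thesis using m(2) by simp
    qed
    then show ?thesis by blast
  qed blast
qed

text \<open>Shifting by \<open>(a, c)\<close> with \<open>a\<close> divisible by high powers of 2
  and \<open>c\<close> in a suitable residue class preserves the comparison of valuations at each
  point of \<open>F\<close>. These shifts form a coset of a lattice within \<open>T\<close>.\<close>

lemma more_even_syndetic_copies:
  fixes T :: "(int \<times> int) set"
  assumes T: "T = Npos \<times> Npos \<or> T = UNIV" and F: "finite F"
  shows "syndetic T {s \<in> T. \<forall>t\<in>F. s + t \<in> more_even \<longleftrightarrow> t \<in> more_even}"
proof -
  \<comment> \<open>No nonzero first coordinate is divisible by \<open>2 ^ k\<close>, so membership
    of points with \<open>m \<noteq> 0\<close> depends only on residues modulo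
    \<open>2 ^ k\<close>.\<close>
  obtain k where k: "\<And>i. i \<in> fst ` F - {0} \<Longrightarrow> \<not> 2 ^ k dvd i"
    using not_power_dvd[of "fst ` F - {0}"] F by auto
  obtain r0 where r0: "r0 > 0" "\<And>a b. r0 dvd a - b \<Longrightarrow> 2 ^ k dvd P a - P b"
    using periodic[of "2 ^ k"] by auto
  obtain N where N: "\<And>n. n \<ge> N \<Longrightarrow> P n \<noteq> 0" using eventually_nonzero by blast
  \<comment> \<open>A multiple of \<open>r0\<close>, so that shifting by \<open>b\<close> does not
    change \<open>P\<close> modulo \<open>2 ^ k\<close>, and so large that \<open>P (b + j)\<close>
    is nonzero and its valuation can be exceeded by that of \<open>a\<close>.\<close>
  define b where "b = r0 * (\<bar>N\<bar> + (\<Sum>j\<in>snd ` F. \<bar>j\<bar>))"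
  have b: "P (b + j) \<noteq> 0" if "j \<in> snd ` F" for j
  proof (rule N)
    have "\<bar>j\<bar> \<le> (\<Sum>j\<in>snd ` F. \<bar>j\<bar>)" using that F by (intro member_le_sum) auto
    then have "- (\<Sum>j\<in>snd ` F. \<bar>j\<bar>) \<le> j" by (simp add: abs_le_iff)
    moreover have "1 * (\<bar>N\<bar> + (\<Sum>j\<in>snd ` F. \<bar>j\<bar>)) \<le> b"
      unfolding b_def using r0(1) by (intro mult_right_mono) (auto simp: sum_nonneg)
    then have "N + (\<Sum>j\<in>snd ` F. \<bar>j\<bar>) \<le> b" using abs_ge_self[of N] by simp
    ultimately show "N \<le> b + j" by linarith
  qed
  obtain l where l: "\<And>j. j \<in> snd ` F \<Longrightarrow> \<not> 2 ^ l dvd P (b + j)"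
    using not_power_dvd[of "(\<lambda>j. P (b + j)) ` snd ` F"] F b by (auto simp: image_iff)
  obtain r1 where r1: "r1 > 0" "\<And>a b. r1 dvd a - b \<Longrightarrow> 2 ^ l dvd P a - P b"
    using periodic[of "2 ^ l"] by auto
  define r where "r = r0 * r1 * 2 ^ l * 2 ^ k"
  have "r > 0" using r0 r1 by (simp add: r_def)
  have rd: "r0 dvd r" "r1 dvd r" "2 ^ l dvd r" "2 ^ k dvd r" by (simp_all add: r_def)
  have "s + t \<in> more_even \<longleftrightarrow> t \<in> more_even"
    if s: "r dvd fst s" "r dvd snd s - b" and t: "t \<in> F" for s t
  proof -
    obtain a c where ac: "s = (a, c)" by fastforce
    obtain i j where ij: "t = (i, j)" by fastforce
    have a: "2 ^ l dvd a" "2 ^ k dvd a" using s(1) rd dvd_trans ac by auto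
    have "r1 dvd (c + j) - (b + j)" using s(2) rd(2) dvd_trans ac by auto
    then have "2 ^ l dvd P (c + j) - P (b + j)" by (rule r1(2))
    moreover have "\<not> 2 ^ l dvd P (b + j)" using l t ij by force
    ultimately have cj: "\<not> 2 ^ l dvd P (c + j)" using dvd_diff_right_iff by metis
    have "r0 dvd c - b" using s(2) rd(1) dvd_trans ac by auto
    moreover have "r0 dvd b" by (simp add: b_def)
    ultimately have "r0 dvd (c - b) + b" by (rule dvd_add)
    then have "r0 dvd (c + j) - j" by simp
    then have Pc: "2 ^ k dvd P (c + j) - P j" by (rule r0(2))
    show ?thesis
    proof (cases "i = 0")
      \<comment> \<open>Here \<open>t\<close> belongs to the set because \<open>m = 0\<close>; after
        the shift the first coordinate \<open>a\<close> is divisible by \<open>2 ^ l\<close>,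
        whereas \<open>P (c + j)\<close> is not.\<close>
      case True
      then show ?thesis using a(1) cj by (auto simp: more_even_def ac ij)
    next
      case False
      then have i: "\<not> 2 ^ k dvd i" using k t ij by force
      have ai: "2 ^ v dvd a + i \<longleftrightarrow> 2 ^ v dvd i" if "v \<le> k" for v
        using a(2) that by (meson dvd_add_right_iff power_le_dvd)
      have Pv: "2 ^ v dvd P (c + j) \<longleftrightarrow> 2 ^ v dvd P j" if "v \<le> k" for v
      proof -
        have "2 ^ v dvd P (c + j) - P j" using Pc that by (rule power_le_dvd)
        then show ?thesis by (metis dvd_add_right_iff diff_add_cancel)
      qed
      have lt: "v \<le> k" if "2 ^ v dvd x" "\<not> 2 ^ k dvd x" for v and x :: int
        using that power_le_dvd[of 2 v x k] by (cases "v \<le> k") auto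
      have "\<not> 2 ^ k dvd a + i" using i ai by blast
      then have "a + i \<noteq> 0" by auto
      then have "s + t \<in> more_even \<longleftrightarrow> (\<exists>v. \<not> 2 ^ v dvd P (c + j) \<and> 2 ^ v dvd a + i)"
        by (simp add: more_even_def ac ij)
      also have "\<dots> \<longleftrightarrow> (\<exists>v. \<not> 2 ^ v dvd P j \<and> 2 ^ v dvd i)"
        using ai Pv lt[OF _ i] lt[OF _ \<open>\<not> 2 ^ k dvd a + i\<close>] by metis
      also have "\<dots> \<longleftrightarrow> t \<in> more_even" using False by (simp add: more_even_def ij)
      finally show ?thesis .
    qed
  qed
  then show ?thesis
    by (intro syndetic_mono[OF syndetic_lattice[OF T \<open>r > 0\<close>, of b]]) auto
qed

text \<open>Boxes of growing side contain a translate of every finite set, and inside a box the set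
  coincides with \<open>more_even\<close>.\<close>

lemma central_more_even_boxes:
  fixes T :: "(int \<times> int) set"
  assumes T: "T = Npos \<times> Npos \<or> T = UNIV"
  shows "central T (more_even \<inter> (\<Union>k. box k))"
proof (rule central_if_copies[where Q = more_even])
  show "more_even \<inter> (\<Union>k. box k) \<subseteq> T" using T box_subset by blast
  show "0 \<in> more_even" by (simp add: more_even_def zero_prod_def)
  show "syndetic T {s \<in> T. \<forall>t\<in>F. s + t \<in> more_even \<longleftrightarrow> t \<in> more_even}" if "finite F" for F
    using more_even_syndetic_copies[OF T that] .
  fix F :: "(int \<times> int) set" assume F: "finite F"
  define k where "k = nat (\<Sum>t\<in>F. \<bar>fst t\<bar> + \<bar>snd t\<bar>)"
  have k: "\<bar>fst t\<bar> \<le> int k" "\<bar>snd t\<bar> \<le> int k" if "t \<in> F" for t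
  proof -
    have "\<bar>fst t\<bar> + \<bar>snd t\<bar> \<le> (\<Sum>t\<in>F. \<bar>fst t\<bar> + \<bar>snd t\<bar>)" using that F by (intro member_le_sum) auto
    then show "\<bar>fst t\<bar> \<le> int k" "\<bar>snd t\<bar> \<le> int k" by (auto simp: k_def)
  qed
  \<comment> \<open>A side of at least \<open>2 * k\<close> leaves room \<open>k\<close> in every
    direction, as \<open>F\<close> may contain negative coordinates.\<close>
  define s where "s = corner (2 * k) + (int k, int k)"
  have len: "2 * int k \<le> len (2 * k)" using int_le_len[of "2 * k"] by simp
  have in_box: "s + t \<in> box (2 * k)" if "\<bar>fst t\<bar> \<le> int k" "\<bar>snd t\<bar> \<le> int k" for t
    using that len by (auto simp: s_def box_def mem_Times_iff)
  have "s \<in> T" using in_box[of 0] box_subset[of "2 * k"] T by auto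
  then show "\<exists>s\<in>T. \<forall>t\<in>F. s + t \<in> more_even \<inter> (\<Union>k. box k) \<longleftrightarrow> s + t \<in> more_even"
  proof (intro bexI[of _ s] ballI)
    fix t assume "t \<in> F"
    then have "s + t \<in> box (2 * k)" using in_box k by simp
    then show "s + t \<in> more_even \<inter> (\<Union>k. box k) \<longleftrightarrow> s + t \<in> more_even" by blast
  qed
qed

lemma val_boxes_pos: "val ` (more_even \<inter> (\<Union>k. box k)) \<subseteq> Npos"
  using box_val_pos by (fastforce simp: Npos_def)

text \<open>
  Fix \<open>y\<close> in an IP set and choose \<open>x\<close> in it with \<open>x > y\<close> and with larger 2-adic valuation than \<open>y\<close>. If
  \<open>x\<close> and \<open>x + y\<close> were values at \<open>(m, n)\<close> and \<open>(m + y, n)\<close>, then the valuation of \<open>P n\<close> would be that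
  of \<open>x\<close>, and smaller than that of \<open>y\<close>.
\<close>

lemma val_more_even_no_FS:
  fixes x :: "nat \<Rightarrow> int"
  assumes FS: "FS UNIV x \<subseteq> val ` (more_even \<inter> (\<Union>k. box k))" (is "_ \<subseteq> ?C")
  shows False
proof -
  have sumC: "sum x \<alpha> \<in> ?C" if "finite \<alpha>" "\<alpha> \<noteq> {}" for \<alpha>
    using FS that by (auto simp: FS_def)
  have xpos: "1 \<le> x i" for i
    using sumC[of "{i}"] val_boxes_pos by (auto simp: Npos_def)
  define y where "y = x 0"
  have y: "y \<in> ?C" using sumC[of "{0}"] by (simp add: y_def)
  obtain l where l: "\<not> 2 ^ l dvd y" using not_power_dvd[of "{y}"] xpos[of 0] by (auto simp: y_def)
  \<comment> \<open>Two prefix sums with the same residue modulo \<open>2 ^ l\<close> bound a block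
    whose sum \<open>z\<close> is divisible by \<open>2 ^ l\<close>; a block longer than
    \<open>y\<close> makes \<open>z > y\<close>.\<close>
  have "finite ((\<lambda>j. sum x {1..<j} mod 2 ^ l) ` {1..})"
    by (rule finite_subset[of _ "{0..<2 ^ l}"]) auto
  from pigeonhole_infinite[OF infinite_Ici this]
  obtain a where a: "infinite {j \<in> {1::nat..}. sum x {1..<j} mod 2 ^ l = sum x {1..<a} mod 2 ^ l}" "1 \<le> a"
    by auto
  then obtain b where b: "a + nat y < b" "sum x {1..<b} mod 2 ^ l = sum x {1..<a} mod 2 ^ l"
    unfolding infinite_nat_iff_unbounded by blast
  define z where "z = sum x {a..<b}"
  have "sum x {1..<b} = sum x {1..<a} + z"
    unfolding z_def using a(2) b(1) by (intro sum.atLeastLessThan_concat[symmetric]) auto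
  then have z2: "2 ^ l dvd z" using b(2) by (metis add_diff_cancel_left' mod_eq_dvd_iff)
  have "of_nat (card {a..<b}) * 1 \<le> z" unfolding z_def by (rule sum_bounded_below) (use xpos in auto)
  then have zy: "y < z" using b(1) by simp
  have z: "z \<in> ?C" unfolding z_def by (rule sumC) (use b(1) in auto)
  \<comment> \<open>\<open>1 \<le> a\<close> keeps index 0 outside the block.\<close>
  have "sum x (insert 0 {a..<b}) = y + z" using a(2) by (simp add: y_def z_def)
  then have zy_mem: "z + y \<in> ?C" using sumC[of "insert 0 {a..<b}"] by (simp add: add.commute)
  from z obtain s where s: "z = val s" "s \<in> more_even" "s \<in> (\<Union>k. box k)" by (elim imageE IntE)
  from y obtain t where t: "y = val t" "t \<in> (\<Union>k. box k)" by (elim imageE IntE)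
  from zy_mem obtain u where u: "z + y = val u" "u \<in> more_even" "u \<in> (\<Union>k. box k)" by (elim imageE IntE)
  note stu = s t u
  obtain i j k where "s \<in> box i" "t \<in> box j" "u \<in> box k" using stu by blast
  then have snd: "snd u = snd s"
    by (rule val_sum_imp_snd_eq) (use stu zy in auto)
  have fst: "fst u = fst s + y" using stu snd by (simp add: val_def)
  have "fst s > 0" "fst u > 0" using stu box_subset by (force simp: Npos_def)+
  then obtain v w where v: "\<not> 2 ^ v dvd P (snd s)" "2 ^ v dvd fst s"
      and w: "\<not> 2 ^ w dvd P (snd s)" "2 ^ w dvd fst s + y"
    using stu snd fst by (auto simp: more_even_def split_beta)
  have Ps: "P (snd s) = z - fst s" using stu by (simp add: val_def)
  \<comment> \<open>For smaller \<open>v\<close>, \<open>2 ^ v\<close> would divide both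
    \<open>z\<close> and \<open>fst s\<close>, hence \<open>P (snd s)\<close>.\<close>
  have "l \<le> v"
  proof (rule ccontr)
    assume "\<not> l \<le> v"
    then have "2 ^ v dvd z" using z2 by (meson power_le_dvd nle_le)
    then show False using v Ps by simp
  qed
  then have m: "2 ^ l dvd fst s" using v(2) by (meson power_le_dvd)
  then have "2 ^ l dvd P (snd s)" using z2 Ps by simp
  then have "l \<le> w" using w(1) by (meson power_le_dvd nle_le)
  then have "2 ^ l dvd fst s + y" using w(2) by (meson power_le_dvd)
  then show False using l m by (simp add: dvd_add_right_iff)
qed

end

section \<open>Large sets and polynomial returns\<close>

lemma star_complement:
  assumes "\<And>D. D \<subseteq> C \<Longrightarrow> P S D \<Longrightarrow> False" "\<And>D. P S D \<Longrightarrow> D \<subseteq> S"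
  shows "star P S (S - C)"
  unfolding star_def using assms by blast

lemma not_star: "P S B \<Longrightarrow> A \<inter> B = {} \<Longrightarrow> \<not> star P S A"
  unfolding star_def by blast

section \<open>Sum-free sets and the notions other than centrality\<close>

definition sum_free :: "int set \<Rightarrow> bool" where
  "sum_free C \<longleftrightarrow> (\<forall>x\<in>C. \<forall>y\<in>C. x + y \<notin> C)"

lemma FS_memI:
  assumes "a \<in> I" "b \<in> I" "a \<noteq> b"
  shows "x a \<in> FS I x" "x b \<in> FS I x" "x a + x b \<in> FS I x"
proof -
  have "sum x \<alpha> \<in> FS I x" if "finite \<alpha>" "\<alpha> \<noteq> {}" "\<alpha> \<subseteq> I" for \<alpha> using that by (auto simp: FS_def)
  from this[of "{a}"] this[of "{b}"] this[of "{a, b}"] assms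
  show "x a \<in> FS I x" "x b \<in> FS I x" "x a + x b \<in> FS I x" by auto
qed

lemma sum_free_FS: "sum_free C \<Longrightarrow> FS I x \<subseteq> C \<Longrightarrow> a \<in> I \<Longrightarrow> b \<in> I \<Longrightarrow> a \<noteq> b \<Longrightarrow> False"
  using FS_memI[of a I b x] unfolding sum_free_def by blast

lemma sum_free_IP_set:
  assumes C: "sum_free C" "D \<subseteq> C" and D: "IP_set S D"
  shows False
proof -
  obtain x :: "nat \<Rightarrow> int" where "FS UNIV x \<subseteq> C" using C(2) D unfolding IP_set_def by blast
  then show False using sum_free_FS[OF C(1), of UNIV x 0 1] by simp
qed

lemma sum_free_IP_n_set:
  assumes C: "sum_free C" "D \<subseteq> C" and n: "n \<ge> 2" and D: "IP_n_set n S D"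
  shows False
proof -
  have ex: "\<exists>F\<in>Q. \<exists>x :: nat \<Rightarrow> int. FS {1..n} x \<subseteq> F" if "finite Q" "partition_on D Q" for Q
    using D that unfolding IP_n_set_def by blast
  \<comment> \<open>The empty set is ruled out by its empty partition, which has no class; then the
    trivial partition yields finite sums inside \<open>D\<close> itself.\<close>
  have "D \<noteq> {}" using ex[of "{}"] by (auto simp: partition_on_empty)
  then have "partition_on D {D}" by (rule partition_on_space)
  then obtain x :: "nat \<Rightarrow> int" where "FS {1..n} x \<subseteq> D" using ex[of "{D}"] by auto
  then show False using sum_free_FS[OF C(1), of "{1..n}" x 1 2] C(2) n by auto
qed

lemma IP_fin_set_imp_IP_n_set: "IP_fin_set S D \<Longrightarrow> n \<ge> 1 \<Longrightarrow> IP_n_set n S D"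
  unfolding IP_fin_set_def IP_n_set_def by blast

lemma sum_free_Delta_set:
  assumes "sum_free C" "D \<subseteq> C" "Delta_set S D"
  shows False
proof -
  obtain x :: "nat \<Rightarrow> int" where x: "{x j - x i |i j. i < j} \<subseteq> D"
    using assms(3) unfolding Delta_set_def by blast
  have diff: "x j - x i \<in> C" if "i < j" for i j using x assms(2) that by blast
  have "x 1 - x 0 \<in> C" "x 2 - x 1 \<in> C" using diff by simp_all
  then have "(x 1 - x 0) + (x 2 - x 1) \<notin> C" using assms(1) unfolding sum_free_def by blast
  then show False using diff[of 0 2] by simp
qed

lemma large_complement_sum_free:
  assumes C: "sum_free C" and L: "L \<in> large_notions" "L \<noteq> CentralStar"
  shows "large L S (S - C)"
proof -
  have IPn: "star (IP_n_set n) S (S - C)" if "n \<ge> 2" for n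
    by (rule star_complement) (use sum_free_IP_n_set[OF C _ that] in \<open>auto simp: IP_n_set_def\<close>)
  have fin: False if "D \<subseteq> C" "IP_fin_set S D" for D
    using sum_free_IP_n_set[OF C that(1), of 2] IP_fin_set_imp_IP_n_set[OF that(2), of 2] by auto
  have "star IP_set S (S - C)" by (rule star_complement) (use sum_free_IP_set[OF C] in \<open>auto simp: IP_set_def\<close>)
  moreover have "star IP_fin_set S (S - C)"
    by (rule star_complement) (use fin in \<open>auto simp: IP_fin_set_def\<close>)
  moreover have "star Delta_set S (S - C)"
    by (rule star_complement) (use sum_free_Delta_set[OF C] in \<open>auto simp: Delta_set_def\<close>)
  ultimately show ?thesis using L IPn by (auto simp: large_notions_def)
qed

lemma not_large_FS:
  fixes x :: "nat \<Rightarrow> 'a::ab_group_add"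
  assumes T: "\<And>s t. s \<in> T \<Longrightarrow> t \<in> T \<Longrightarrow> s + t \<in> T" and x: "range x \<subseteq> T"
    and Delta: "Delta_set T (FS UNIV x)" and A: "A \<inter> FS UNIV x = {}"
    and L: "L \<in> large_notions" "L \<noteq> CentralStar"
  shows "\<not> large L T A"
proof -
  have fin: "IP_fin_set T (FS UNIV x)" by (rule IP_fin_set_FS[OF T x])
  then have "FS UNIV x \<subseteq> T" by (simp add: IP_fin_set_def)
  then have "IP_set T (FS UNIV x)" using x by (auto simp: IP_set_def)
  then show ?thesis
    using L fin Delta not_star[OF _ A] IP_fin_set_imp_IP_n_set[OF fin] by (auto simp: large_notions_def)
qed

text \<open>A single one of the \<open>d\<close> conditions decides: the \<open>i\<close>-th already
  puts \<open>m + P n\<close> outside \<open>C\<close>.\<close>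

lemma poly_returns_disjoint:
  assumes P: "\<And>n. of_int (P n) = poly (p i) (of_int n)" and i: "i \<in> {1..d}"
    and B: "\<And>s. s \<in> B \<Longrightarrow> fst s + P (snd s) \<in> C"
  shows "poly_returns S d p (S - C) \<inter> B = {}"
proof -
  have False if s: "(m, n) \<in> poly_returns S d p (S - C)" "(m, n) \<in> B" for m n
  proof -
    have "of_int m + poly (p i) (of_int n) \<in> (of_int ` (S - C) :: real set)"
      using s(1) i by (auto simp: poly_returns_def)
    then have "real_of_int (m + P n) \<in> of_int ` (S - C)" by (simp add: P)
    then obtain a where "a \<in> S - C" "real_of_int (m + P n) = of_int a" by blast
    moreover from this have "m + P n = a" by (simp only: of_int_eq_iff)
    ultimately have "m + P n \<notin> C" by simp
    then show False using B[OF s(2)] by simp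
  qed
  then show ?thesis by fastforce
qed

section \<open>The two parts of the theorem\<close>

lemma thick_poly_returns:
  assumes d: "d \<ge> 1" and p: "\<And>i. i \<in> {1..d} \<Longrightarrow> integral_poly (p i)" and A: "thick Npos A"
  shows "thick (Npos \<times> Npos) (poly_returns Npos d p A)"
  unfolding thick_def
proof (intro conjI allI impI)
  show "poly_returns Npos d p A \<subseteq> Npos \<times> Npos" by (auto simp: poly_returns_def)
  fix F :: "(int \<times> int) set" assume F: "finite F" "F \<noteq> {}" "F \<subseteq> Npos \<times> Npos"
  have "\<forall>i n. \<exists>k. i \<in> {1..d} \<longrightarrow> poly (p i) (of_int n) = of_int k"
    using p unfolding integral_poly_def by (metis Ints_cases)
  then obtain Q :: "nat \<Rightarrow> int \<Rightarrow> int" where Q: "\<And>i n. i \<in> {1..d} \<Longrightarrow> poly (p i) (of_int n) = of_int (Q i n)"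
    by metis
  \<comment> \<open>The final translation moves the second coordinate by 1, the least step in
    \<open>Npos\<close>, so the values are taken at \<open>n + 1\<close>.\<close>
  define G where "G = (\<lambda>((m, n), i). m + Q i (n + 1)) ` (F \<times> {1..d})"
  have G: "finite G" "G \<noteq> {}" using F d by (auto simp: G_def)
  \<comment> \<open>Thickness concerns finite subsets of \<open>Npos\<close>; adding
    \<open>c\<close> makes all values positive.\<close>
  define c where "c = 1 + (\<Sum>g\<in>G. \<bar>g\<bar>)"
  have c: "1 \<le> g + c" if "g \<in> G" for g
  proof -
    have "\<bar>g\<bar> \<le> (\<Sum>g\<in>G. \<bar>g\<bar>)" using that G by (intro member_le_sum) auto
    then show ?thesis by (simp add: c_def)
  qed
  have "c \<ge> 1" by (simp add: c_def sum_nonneg)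
  have "finite ((\<lambda>g. g + c) ` G)" "(\<lambda>g. g + c) ` G \<noteq> {}" "(\<lambda>g. g + c) ` G \<subseteq> Npos"
    using G c by (auto simp: Npos_def)
  then have "\<exists>s\<in>Npos. (\<lambda>f. f + s) ` ((\<lambda>g. g + c) ` G) \<subseteq> A"
    using A unfolding thick_def by simp
  then obtain s where s: "s \<in> Npos" "(\<lambda>f. f + s) ` ((\<lambda>g. g + c) ` G) \<subseteq> A" ..
  then have sA: "g + c + s \<in> A" if "g \<in> G" for g using that by blast
  have "(m, n) + (c + s, 1) \<in> poly_returns Npos d p A" if mn: "(m, n) \<in> F" for m n
  proof -
    have "of_int (m + (c + s)) + poly (p i) (of_int (n + 1)) \<in> (of_int ` A :: real set)" if "i \<in> {1..d}" for i
    proof -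
      have "m + Q i (n + 1) \<in> G" using mn that by (force simp: G_def)
      then have "m + Q i (n + 1) + c + s \<in> A" by (rule sA)
      moreover have "of_int (m + (c + s)) + poly (p i) (of_int (n + 1)) = real_of_int (m + Q i (n + 1) + c + s)"
        unfolding Q[OF that] by simp
      ultimately show ?thesis by blast
    qed
    moreover have "m + (c + s) \<in> Npos" "n + 1 \<in> Npos"
      using mn F(3) \<open>c \<ge> 1\<close> s(1) by (auto simp: Npos_def)
    ultimately show ?thesis by (simp add: poly_returns_def)
  qed
  moreover have "(c + s, 1) \<in> Npos \<times> Npos" using \<open>c \<ge> 1\<close> s(1) by (auto simp: Npos_def)
  ultimately show "\<exists>s\<in>Npos \<times> Npos. (\<lambda>f. f + s) ` F \<subseteq> poly_returns Npos d p A"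
    by (intro bexI[of _ "(c + s, 1)"] image_subsetI) (simp_all only: split_paired_all)
qed

lemma exists_large_not_large:
  fixes S :: "int set" and T :: "(int \<times> int) set"
  assumes p: "integral_poly (p i)" "i \<in> {1..d}" "degree (p i) \<ge> 2" and L: "L \<in> large_notions"
    and ST: "S = Npos \<and> T = Npos \<times> Npos \<or> S = UNIV \<and> T = UNIV"
  shows "\<exists>A. large L S A \<and> \<not> large L T (poly_returns S d p A)"
proof -
  have "\<forall>n. \<exists>k. real_of_int k = poly (p i) (of_int n)"
    using p(1) unfolding integral_poly_def by (metis Ints_cases)
  then obtain P where P: "\<And>n. real_of_int (P n) = poly (p i) (of_int n)" by metis
  interpret periodic_wide_gaps P
    by unfold_locales (use poly_gaps[OF P p(3)] integer_valued_poly_periodic[OF P] in auto)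
  have T: "T = Npos \<times> Npos \<or> T = UNIV" using ST by blast
  have Sadd: "s + t \<in> S" if "s \<in> S" "t \<in> S" for s t using ST that by (auto simp: Npos_def)
  have Tadd: "s + t \<in> T" if "s \<in> T" "t \<in> T" for s t using T that by (auto simp: Npos_def)
  show ?thesis
  proof (cases "L = CentralStar")
    case True
    define B where "B = more_even \<inter> (\<Union>k. box k)"
    have "star central S (S - val ` B)"
    proof (rule star_complement)
      fix D assume D: "D \<subseteq> val ` B" "central S D"
      have "IP_set S D" using central_imp_IP_set[OF Sadd D(2)] .
      then obtain x :: "nat \<Rightarrow> int" where "FS UNIV x \<subseteq> D" unfolding IP_set_def by blast
      then show False using val_more_even_no_FS[of x] D(1) unfolding B_def by blast
    qed (simp add: central_def)
    moreover have "\<not> star central T (poly_returns S d p (S - val ` B))"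
      by (rule not_star[where B = B], unfold B_def, rule central_more_even_boxes[OF T])
        (rule poly_returns_disjoint[of P p i, OF P p(2)], simp add: val_def[symmetric])
    ultimately show ?thesis using True by auto
  next
    case False
    define C where "C = val ` FS UNIV corner"
    have "sum_free C" using val_FS_sum_free unfolding sum_free_def C_def by blast
    then have "large L S (S - C)" using large_complement_sum_free L False by blast
    moreover have "\<not> large L T (poly_returns S d p (S - C))"
    proof (rule not_large_FS[OF Tadd _ corner_Delta_set[OF Tadd] _ L False])
      show "Npos \<times> Npos \<subseteq> T" using T by blast
      moreover have "corner k \<in> Npos \<times> Npos" for k
        using corner_pos(1,3)[of k] by (simp add: Npos_def mem_Times_iff)
      ultimately show "range corner \<subseteq> T" by blast
      show "poly_returns S d p (S - C) \<inter> FS UNIV corner = {}"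
        by (rule poly_returns_disjoint[of P p i, OF P p(2)]) (simp add: C_def val_def[symmetric])
    qed
    ultimately show ?thesis by blast
  qed
qed

theorem theorem1p2:
  fixes d :: nat and p :: "nat \<Rightarrow> real poly"
  assumes "d \<ge> 1"
    and "\<And>i. i \<in> {1..d} \<Longrightarrow> integral_poly (p i)"
    and "\<And>i. i \<in> {1..d} \<Longrightarrow> poly (p i) 0 = 0"
  shows "(\<forall>A. thick Npos A \<longrightarrow> thick (Npos \<times> Npos) (poly_returns Npos d p A)) \<and>
    (\<forall>L \<in> large_notions. Max ((\<lambda>i. degree (p i)) ` {1..d}) \<ge> 2 \<longrightarrow>
       (\<exists>A. large L Npos A \<and> \<not> large L (Npos \<times> Npos) (poly_returns Npos d p A)) \<and>
       (\<exists>A. large L (UNIV :: int set) A \<and>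
            \<not> large L (UNIV :: (int \<times> int) set) (poly_returns UNIV d p A)))"
proof (intro conjI allI ballI impI)
  show "thick (Npos \<times> Npos) (poly_returns Npos d p A)" if "thick Npos A" for A
    using thick_poly_returns[of d p, OF assms(1,2) that] .
  fix L assume L: "L \<in> large_notions" and deg: "Max ((\<lambda>i. degree (p i)) ` {1..d}) \<ge> 2"
  have "Max ((\<lambda>i. degree (p i)) ` {1..d}) \<in> (\<lambda>i. degree (p i)) ` {1..d}"
    using assms(1) by (intro Max_in) auto
  then obtain i where i: "i \<in> {1..d}" "degree (p i) \<ge> 2" using deg by auto
  show "\<exists>A. large L Npos A \<and> \<not> large L (Npos \<times> Npos) (poly_returns Npos d p A)"
    "\<exists>A. large L (UNIV :: int set) A \<and> \<not> large L (UNIV :: (int \<times> int) set) (poly_returns UNIV d p A)"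
    by (rule exists_large_not_large[of p, OF assms(2)[OF i(1)] i L]; simp)+
qed

end
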